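(* Let $\theta:N_3A\to A$ be a doubly degenerate $3$-category in the non-reflexive version of Penon's definition (an $N_3$-algebra such that $A$ has only one $0$-cell and only one $1$-cell), and let $TA$ be the free strict $3$-category on the non-reflexive globular set $A$. Then $TA(1)\neq 1$ although $A(1)=1$: the unique $1$-cell of $A$ generates the $1$-cells of $TA$, but there is a new (formal) identity $1$-cell. Consequently, for $2$-cells $\alpha,\beta$ of $A$ we no longer have $\alpha\circ\beta=\beta\circ\alpha$ in $TA$ (i.e. this identity, which holds in the reflexive version, is not generally available), where $\circ$ is vertical composition of $2$-cells. Indeed the composites appearing in the Eckmann–Hilton argument (listed in the context) do not even have the same source and target in $TA$, and so are not all equal.
   Context: A $3$-dimensional (non-reflexive) globular set $A$ consists of sets $A(0),A(1),A(2),A(3)$ and maps $s,t:A(k)\to A(k-1)$ for $1\le k\le3$ with $ss=st$ and $ts=tt$. It is reflexive if it is also equipped with maps $i:A(k)\to A(k+1)$, $0\le k\le2$, with $si=ti=1$. $TA$ is the value at $A$ of the free strict $3$-category monad on non-reflexive globular sets; in it identities are freely added. "$TA(1)=1$" means that $TA$ has exactly one $1$-cell. The monad $N_3$: a magma is a $3$-dimensional reflexive globular set with binary composites $\beta\circ_k\alpha$ of $m$-cells along $k$-cells, for all $0\le k<m\le3$ and $t^{m-k}\alpha=s^{m-k}\beta$, having the same sources and targets as in a strict $3$-category but satisfying no axioms. A contraction on a map $f:X\to B$ of $3$-dimensional reflexive globular sets gives, for $k<3$ and parallel $k$-cells $\alpha,\beta$ of $X$ (same source and target, or $k=0$) with $f\alpha=f\beta$,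 a $(k+1)$-cell $[\alpha,\beta]:\alpha\to\beta$ with $f[\alpha,\beta]=i(f\alpha)$ and $[\alpha,\alpha]=i\alpha$, and requires parallel $3$-cells $\alpha,\beta$ with $f\alpha=f\beta$ to be equal. Let $\mathcal{Q}$ be the category of magma maps $f:X\to B$ from a magma $X$ to (the underlying magma of) a strict $3$-category $B$, equipped with a contraction; morphisms are commuting squares of a magma map and a strict $3$-functor preserving contraction cells. The functor from $\mathcal{Q}$ to $3$-dimensional non-reflexive globular sets, sending such an object to the underlying globular set of $X$, has a left adjoint, and $N_3$ is the induced monad. In the reflexive version one uses instead the monad on reflexive globular sets induced by the forgetful functor from $\mathcal{Q}$, and the free strict $3$-category $T_RA$ on a reflexive globular set $A$; there the unique $1$-cell of a doubly degenerate $A$ becomes the identity $1$-cell of $T_RA$, so that $\alpha\circ\beta=\beta\circ\alpha$ in $T_RA$. Writing $*$ for horizontal composition (along $0$-cells), $\circ$ for vertical composition (along $1$-cells) and $1$ for the identity $2$-cell on the unique $1$-cell of $A$, the Eckmann–Hilton composites are, in cyclic order: $\beta*\alpha$, $(\beta\circ1)*(1\circ\alpha)$, $(\beta*1)\circ(1*\alpha)$, $\beta\circ\alpha$, $(1*\beta)\circ(\alpha*1)$, $(1\circ\alpha)*(\beta\circ1)$, $\alpha*\beta$, $(\alpha\circ1)*(1\circ\beta)$, $(\alpha*1)\circ(1*\beta)$, $\alpha\circ\beta$, $(1*\alpha)\circ(\beta*1)$, $(1\circ\beta)*(\alpha\circ1)$. *)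

theory Defs
  imports Main
begin

section \<open>Globular sets, magmas and strict 3-categories\<close>

text \<open>All structures are 3-dimensional: only cells of dimension at most 3 are ever constrained.
  A family of sets A(0), ..., A(3) is given by carriers in one type; the carriers
  of different dimensions need not be disjoint.  \<open>src A k\<close> and \<open>tgt A k\<close> are the maps from A(k)
  to A(k-1), \<open>idn A k\<close> is the map i from A(k) to A(k+1), and \<open>cmp A m k y x\<close> is the composite
  of the m-cells x, y along a k-cell, written "y o_k x" (first x, then y).\<close>

record 'a glob =
  cells :: "nat \<Rightarrow> 'a set"
  src :: "nat \<Rightarrow> 'a \<Rightarrow> 'a"
  tgt :: "nat \<Rightarrow> 'a \<Rightarrow> 'a"

record 'a rglob = "'a glob" +
  idn :: "nat \<Rightarrow> 'a \<Rightarrow> 'a"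

record 'a magma = "'a rglob" +
  cmp :: "nat \<Rightarrow> nat \<Rightarrow> 'a \<Rightarrow> 'a \<Rightarrow> 'a"

definition globular :: "('a, 'z) glob_scheme \<Rightarrow> bool" where
  "globular A \<longleftrightarrow>
     (\<forall>k<3. \<forall>a\<in>cells A (Suc k). src A (Suc k) a \<in> cells A k \<and> tgt A (Suc k) a \<in> cells A k) \<and>
     (\<forall>k<2. \<forall>a\<in>cells A (Suc (Suc k)).
        src A (Suc k) (src A (Suc (Suc k)) a) = src A (Suc k) (tgt A (Suc (Suc k)) a) \<and>
        tgt A (Suc k) (src A (Suc (Suc k)) a) = tgt A (Suc k) (tgt A (Suc (Suc k)) a))"

definition reflexive_globular :: "('a, 'z) rglob_scheme \<Rightarrow> bool" where
  "reflexive_globular A \<longleftrightarrow> globular A \<and>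
     (\<forall>k<3. \<forall>a\<in>cells A k. idn A k a \<in> cells A (Suc k) \<and>
        src A (Suc k) (idn A k a) = a \<and> tgt A (Suc k) (idn A k a) = a)"

definition uglob :: "('a, 'z) glob_scheme \<Rightarrow> 'a glob" where
  "uglob A = \<lparr>cells = cells A, src = src A, tgt = tgt A\<rparr>"

text \<open>Iterated source and target of an m-cell in dimension k, and iterated identity on a k-cell
  in dimension m.\<close>

primrec src_to :: "('a, 'z) glob_scheme \<Rightarrow> nat \<Rightarrow> nat \<Rightarrow> 'a \<Rightarrow> 'a" where
  "src_to A k 0 a = a"
| "src_to A k (Suc m) a = (if k \<le> m then src_to A k m (src A (Suc m) a) else a)"

primrec tgt_to :: "('a, 'z) glob_scheme \<Rightarrow> nat \<Rightarrow> nat \<Rightarrow> 'a \<Rightarrow> 'a" where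
  "tgt_to A k 0 a = a"
| "tgt_to A k (Suc m) a = (if k \<le> m then tgt_to A k m (tgt A (Suc m) a) else a)"

primrec idn_to :: "('a, 'z) rglob_scheme \<Rightarrow> nat \<Rightarrow> nat \<Rightarrow> 'a \<Rightarrow> 'a" where
  "idn_to A k 0 a = a"
| "idn_to A k (Suc m) a = (if k \<le> m then idn A m (idn_to A k m a) else a)"

definition parallel :: "('a, 'z) glob_scheme \<Rightarrow> nat \<Rightarrow> 'a \<Rightarrow> 'a \<Rightarrow> bool" where
  "parallel A k a b \<longleftrightarrow> a \<in> cells A k \<and> b \<in> cells A k \<and>
     (k = 0 \<or> (src A k a = src A k b \<and> tgt A k a = tgt A k b))"

definition is_magma :: "('a, 'z) magma_scheme \<Rightarrow> bool" where
  "is_magma M \<longleftrightarrow> reflexive_globular M \<and>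
     (\<forall>m k. k \<le> m \<and> m < 3 \<longrightarrow>
       (\<forall>x\<in>cells M (Suc m). \<forall>y\<in>cells M (Suc m).
         tgt_to M k (Suc m) x = src_to M k (Suc m) y \<longrightarrow>
           cmp M (Suc m) k y x \<in> cells M (Suc m) \<and>
           src M (Suc m) (cmp M (Suc m) k y x) =
             (if k = m then src M (Suc m) x
              else cmp M m k (src M (Suc m) y) (src M (Suc m) x)) \<and>
           tgt M (Suc m) (cmp M (Suc m) k y x) =
             (if k = m then tgt M (Suc m) y
              else cmp M m k (tgt M (Suc m) y) (tgt M (Suc m) x))))"

definition strict_3cat :: "('a, 'z) magma_scheme \<Rightarrow> bool" where
  "strict_3cat M \<longleftrightarrow> is_magma M \<and>
     \<comment> \<open>associativity\<close>
     (\<forall>m k. k < m \<and> m \<le> 3 \<longrightarrow>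
       (\<forall>x\<in>cells M m. \<forall>y\<in>cells M m. \<forall>z\<in>cells M m.
         tgt_to M k m x = src_to M k m y \<and> tgt_to M k m y = src_to M k m z \<longrightarrow>
           cmp M m k (cmp M m k z y) x = cmp M m k z (cmp M m k y x))) \<and>
     \<comment> \<open>units\<close>
     (\<forall>m k. k < m \<and> m \<le> 3 \<longrightarrow>
       (\<forall>x\<in>cells M m.
           cmp M m k x (idn_to M k m (src_to M k m x)) = x \<and>
           cmp M m k (idn_to M k m (tgt_to M k m x)) x = x)) \<and>
     \<comment> \<open>interchange\<close>
     (\<forall>m l k. k < l \<and> l < m \<and> m \<le> 3 \<longrightarrow>
       (\<forall>x\<in>cells M m. \<forall>y\<in>cells M m. \<forall>z\<in>cells M m. \<forall>w\<in>cells M m.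
         tgt_to M l m x = src_to M l m y \<and> tgt_to M l m z = src_to M l m w \<and>
         tgt_to M k m x = src_to M k m z \<longrightarrow>
           cmp M m k (cmp M m l w z) (cmp M m l y x) =
           cmp M m l (cmp M m k w y) (cmp M m k z x))) \<and>
     \<comment> \<open>functoriality of identities\<close>
     (\<forall>m k. k < m \<and> m < 3 \<longrightarrow>
       (\<forall>x\<in>cells M m. \<forall>y\<in>cells M m.
         tgt_to M k m x = src_to M k m y \<longrightarrow>
           cmp M (Suc m) k (idn M m y) (idn M m x) = idn M m (cmp M m k y x)))"

definition glob_map ::
  "('a, 'y) glob_scheme \<Rightarrow> ('b, 'z) glob_scheme \<Rightarrow> (nat \<Rightarrow> 'a \<Rightarrow> 'b) \<Rightarrow> bool" where
  "glob_map A B h \<longleftrightarrow>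
     (\<forall>k\<le>3. \<forall>a\<in>cells A k. h k a \<in> cells B k) \<and>
     (\<forall>k<3. \<forall>a\<in>cells A (Suc k).
        h k (src A (Suc k) a) = src B (Suc k) (h (Suc k) a) \<and>
        h k (tgt A (Suc k) a) = tgt B (Suc k) (h (Suc k) a))"

text \<open>Between strict 3-categories, a magma map is exactly a strict 3-functor.\<close>

definition magma_map ::
  "('a, 'y) magma_scheme \<Rightarrow> ('b, 'z) magma_scheme \<Rightarrow> (nat \<Rightarrow> 'a \<Rightarrow> 'b) \<Rightarrow> bool" where
  "magma_map A B h \<longleftrightarrow> glob_map A B h \<and>
     (\<forall>k<3. \<forall>a\<in>cells A k. h (Suc k) (idn A k a) = idn B k (h k a)) \<and>
     (\<forall>m k. k < m \<and> m \<le> 3 \<longrightarrow>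
       (\<forall>x\<in>cells A m. \<forall>y\<in>cells A m. tgt_to A k m x = src_to A k m y \<longrightarrow>
         h m (cmp A m k y x) = cmp B m k (h m y) (h m x)))"

definition doubly_degenerate :: "('a, 'z) glob_scheme \<Rightarrow> bool" where
  "doubly_degenerate A \<longleftrightarrow> (\<exists>!x. x \<in> cells A 0) \<and> (\<exists>!u. u \<in> cells A 1)"


section \<open>Free strict 3-categories\<close>

text \<open>Formal terms.  \<open>Con k x y\<close> is a formal contraction (k+1)-cell from x to y; it is used
  only for the free object of the category Q below, and no term containing it is a
  well-formed term of a free strict 3-category.\<close>

datatype 'a trm =
    Gen nat 'a
  | Idn nat "'a trm"
  | Cmp nat nat "'a trm" "'a trm"
  | Con nat "'a trm" "'a trm"

fun tsrc :: "'a glob \<Rightarrow> 'a trm \<Rightarrow> 'a trm" where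
  "tsrc A (Gen k a) = Gen (k - 1) (src A k a)"
| "tsrc A (Idn k x) = x"
| "tsrc A (Cmp m k y x) =
     (if m = Suc k then tsrc A x else Cmp (m - 1) k (tsrc A y) (tsrc A x))"
| "tsrc A (Con k x y) = x"

fun ttgt :: "'a glob \<Rightarrow> 'a trm \<Rightarrow> 'a trm" where
  "ttgt A (Gen k a) = Gen (k - 1) (tgt A k a)"
| "ttgt A (Idn k x) = x"
| "ttgt A (Cmp m k y x) =
     (if m = Suc k then ttgt A y else Cmp (m - 1) k (ttgt A y) (ttgt A x))"
| "ttgt A (Con k x y) = y"

definition raw :: "'a glob \<Rightarrow> 'a trm magma" where
  "raw A = \<lparr>cells = (\<lambda>_. UNIV), src = (\<lambda>_. tsrc A), tgt = (\<lambda>_. ttgt A), idn = Idn, cmp = Cmp\<rparr>"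

text \<open>The least congruence on terms satisfying the axioms of a strict 3-category; it is a
  partial equivalence relation for each dimension m, and a term x is a well-formed m-dimensional
  term iff \<open>teq A I m x x\<close>.  A triple (k,a,b) in I demands that the generating (k+1)-cell b be
  the identity on the generating k-cell a.\<close>

inductive teq :: "'a glob \<Rightarrow> (nat \<times> 'a \<times> 'a) set \<Rightarrow> nat \<Rightarrow> 'a trm \<Rightarrow> 'a trm \<Rightarrow> bool"
  for A I where
  gen: "k \<le> 3 \<Longrightarrow> a \<in> cells A k \<Longrightarrow> teq A I k (Gen k a) (Gen k a)"
| gen_idn: "k < 3 \<Longrightarrow> (k, a, b) \<in> I \<Longrightarrow> a \<in> cells A k \<Longrightarrow> b \<in> cells A (Suc k) \<Longrightarrow>
    teq A I (Suc k) (Gen (Suc k) b) (Idn k (Gen k a))"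
| sym: "teq A I m x y \<Longrightarrow> teq A I m y x"
| trans: "teq A I m x y \<Longrightarrow> teq A I m y z \<Longrightarrow> teq A I m x z"
| src: "teq A I (Suc m) x y \<Longrightarrow> teq A I m (tsrc A x) (tsrc A y)"
| tgt: "teq A I (Suc m) x y \<Longrightarrow> teq A I m (ttgt A x) (ttgt A y)"
| idn: "k < 3 \<Longrightarrow> teq A I k x y \<Longrightarrow> teq A I (Suc k) (Idn k x) (Idn k y)"
| cmp: "k < m \<Longrightarrow> m \<le> 3 \<Longrightarrow> teq A I m x x' \<Longrightarrow> teq A I m y y' \<Longrightarrow>
    teq A I k (tgt_to (raw A) k m x) (src_to (raw A) k m y) \<Longrightarrow>
    teq A I m (Cmp m k y x) (Cmp m k y' x')"
| glob_src: "teq A I (Suc (Suc m)) x x \<Longrightarrow> teq A I m (tsrc A (tsrc A x)) (tsrc A (ttgt A x))"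
| glob_tgt: "teq A I (Suc (Suc m)) x x \<Longrightarrow> teq A I m (ttgt A (tsrc A x)) (ttgt A (ttgt A x))"
| assoc: "k < m \<Longrightarrow> m \<le> 3 \<Longrightarrow> teq A I m x x \<Longrightarrow> teq A I m y y \<Longrightarrow> teq A I m z z \<Longrightarrow>
    teq A I k (tgt_to (raw A) k m x) (src_to (raw A) k m y) \<Longrightarrow>
    teq A I k (tgt_to (raw A) k m y) (src_to (raw A) k m z) \<Longrightarrow>
    teq A I m (Cmp m k (Cmp m k z y) x) (Cmp m k z (Cmp m k y x))"
| unit_src: "k < m \<Longrightarrow> m \<le> 3 \<Longrightarrow> teq A I m x x \<Longrightarrow>
    teq A I m (Cmp m k x (idn_to (raw A) k m (src_to (raw A) k m x))) x"
| unit_tgt: "k < m \<Longrightarrow> m \<le> 3 \<Longrightarrow> teq A I m x x \<Longrightarrow>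
    teq A I m (Cmp m k (idn_to (raw A) k m (tgt_to (raw A) k m x)) x) x"
| interchange: "k < l \<Longrightarrow> l < m \<Longrightarrow> m \<le> 3 \<Longrightarrow>
    teq A I m x x \<Longrightarrow> teq A I m y y \<Longrightarrow> teq A I m z z \<Longrightarrow> teq A I m w w \<Longrightarrow>
    teq A I l (tgt_to (raw A) l m x) (src_to (raw A) l m y) \<Longrightarrow>
    teq A I l (tgt_to (raw A) l m z) (src_to (raw A) l m w) \<Longrightarrow>
    teq A I k (tgt_to (raw A) k m x) (src_to (raw A) k m z) \<Longrightarrow>
    teq A I m (Cmp m k (Cmp m l w z) (Cmp m l y x)) (Cmp m l (Cmp m k w y) (Cmp m k z x))"
| idn_cmp: "k < m \<Longrightarrow> m < 3 \<Longrightarrow> teq A I m x x \<Longrightarrow> teq A I m y y \<Longrightarrow>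
    teq A I k (tgt_to (raw A) k m x) (src_to (raw A) k m y) \<Longrightarrow>
    teq A I (Suc m) (Cmp (Suc m) k (Idn m y) (Idn m x)) (Idn m (Cmp m k y x))"

text \<open>The structure of terms modulo a graded partial congruence E (a cell is an equivalence
  class of well-formed terms).\<close>

definition cls :: "(nat \<Rightarrow> 'a trm \<Rightarrow> 'a trm \<Rightarrow> bool) \<Rightarrow> nat \<Rightarrow> 'a trm \<Rightarrow> 'a trm set" where
  "cls E m x = {y. E m x y}"

definition rep :: "'a trm set \<Rightarrow> 'a trm" where
  "rep X = (SOME x. x \<in> X)"

definition term_magma ::
  "'a glob \<Rightarrow> (nat \<Rightarrow> 'a trm \<Rightarrow> 'a trm \<Rightarrow> bool) \<Rightarrow> 'a trm set magma" where
  "term_magma A E =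
     \<lparr>cells = (\<lambda>m. {cls E m x | x. E m x x}),
      src = (\<lambda>m X. cls E (m - 1) (tsrc A (rep X))),
      tgt = (\<lambda>m X. cls E (m - 1) (ttgt A (rep X))),
      idn = (\<lambda>k X. cls E (Suc k) (Idn k (rep X))),
      cmp = (\<lambda>m k Y X. cls E m (Cmp m k (rep Y) (rep X)))\<rparr>"

text \<open>The free strict 3-category TA on a non-reflexive globular set A.\<close>

definition free_cat :: "'a glob \<Rightarrow> 'a trm set magma" where
  "free_cat A = term_magma A (teq A {})"

definition free_cat_unit :: "'a glob \<Rightarrow> nat \<Rightarrow> 'a \<Rightarrow> 'a trm set" where
  "free_cat_unit A k a = cls (teq A {}) k (Gen k a)"

text \<open>The free strict 3-category on a reflexive globular set: the given identities
  become the identities of the 3-category.\<close>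

definition idn_pairs :: "'a rglob \<Rightarrow> (nat \<times> 'a \<times> 'a) set" where
  "idn_pairs R = {(k, a, idn R k a) | k a. k < 3 \<and> a \<in> cells R k}"

definition free_cat_refl :: "'a rglob \<Rightarrow> 'a trm set magma" where
  "free_cat_refl R = term_magma (uglob R) (teq (uglob R) (idn_pairs R))"

definition free_cat_refl_unit :: "'a rglob \<Rightarrow> nat \<Rightarrow> 'a \<Rightarrow> 'a trm set" where
  "free_cat_refl_unit R k a = cls (teq (uglob R) (idn_pairs R)) k (Gen k a)"


section \<open>The category Q and Penon's monad\<close>

record ('x, 'b) qobj =
  qX :: "'x magma"
  qB :: "'b magma"
  qf :: "nat \<Rightarrow> 'x \<Rightarrow> 'b"
  qc :: "nat \<Rightarrow> 'x \<Rightarrow> 'x \<Rightarrow> 'x"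

definition contraction ::
  "'x magma \<Rightarrow> 'b magma \<Rightarrow> (nat \<Rightarrow> 'x \<Rightarrow> 'b) \<Rightarrow> (nat \<Rightarrow> 'x \<Rightarrow> 'x \<Rightarrow> 'x) \<Rightarrow> bool" where
  "contraction X B f c \<longleftrightarrow>
     (\<forall>k<3. \<forall>x y. parallel X k x y \<and> f k x = f k y \<longrightarrow>
        c k x y \<in> cells X (Suc k) \<and>
        src X (Suc k) (c k x y) = x \<and> tgt X (Suc k) (c k x y) = y \<and>
        f (Suc k) (c k x y) = idn B k (f k x)) \<and>
     (\<forall>k<3. \<forall>x\<in>cells X k. c k x x = idn X k x) \<and>
     (\<forall>x y. parallel X 3 x y \<and> f 3 x = f 3 y \<longrightarrow> x = y)"

definition Q_object :: "('x, 'b) qobj \<Rightarrow> bool" where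
  "Q_object Q \<longleftrightarrow> is_magma (qX Q) \<and> strict_3cat (qB Q) \<and> magma_map (qX Q) (qB Q) (qf Q) \<and>
     contraction (qX Q) (qB Q) (qf Q) (qc Q)"

definition Q_morphism ::
  "('x, 'b) qobj \<Rightarrow> ('y, 'd) qobj \<Rightarrow> (nat \<Rightarrow> 'x \<Rightarrow> 'y) \<Rightarrow> (nat \<Rightarrow> 'b \<Rightarrow> 'd) \<Rightarrow> bool" where
  "Q_morphism P Q h g \<longleftrightarrow> magma_map (qX P) (qX Q) h \<and> magma_map (qB P) (qB Q) g \<and>
     (\<forall>k\<le>3. \<forall>x\<in>cells (qX P) k. qf Q k (h k x) = g k (qf P k x)) \<and>
     (\<forall>k<3. \<forall>x y. parallel (qX P) k x y \<and> qf P k x = qf P k y \<longrightarrow>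
        h (Suc k) (qc P k x y) = qc Q k (h k x) (h k y))"

text \<open>Evaluation of terms in a magma M, given values of generators and contraction cells.\<close>

primrec ev :: "('x, 'z) magma_scheme \<Rightarrow> (nat \<Rightarrow> 'x \<Rightarrow> 'x \<Rightarrow> 'x) \<Rightarrow> (nat \<Rightarrow> 'a \<Rightarrow> 'x) \<Rightarrow>
    'a trm \<Rightarrow> 'x" where
  "ev M c g (Gen k a) = g k a"
| "ev M c g (Idn k x) = idn M k (ev M c g x)"
| "ev M c g (Cmp m k y x) = cmp M m k (ev M c g y) (ev M c g x)"
| "ev M c g (Con k x y) = c k (ev M c g x) (ev M c g y)"

text \<open>The free Q-object on A lies over TA.  The map to TA sends contraction cells to
  identities; \<open>peq\<close> is the least congruence satisfying the axioms of a contraction.\<close>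

definition proj :: "'a glob \<Rightarrow> 'a trm \<Rightarrow> 'a trm set" where
  "proj A = ev (free_cat A) (\<lambda>k X Y. idn (free_cat A) k X) (free_cat_unit A)"

inductive peq :: "'a glob \<Rightarrow> nat \<Rightarrow> 'a trm \<Rightarrow> 'a trm \<Rightarrow> bool" for A where
  gen: "k \<le> 3 \<Longrightarrow> a \<in> cells A k \<Longrightarrow> peq A k (Gen k a) (Gen k a)"
| sym: "peq A m x y \<Longrightarrow> peq A m y x"
| trans: "peq A m x y \<Longrightarrow> peq A m y z \<Longrightarrow> peq A m x z"
| src: "peq A (Suc m) x y \<Longrightarrow> peq A m (tsrc A x) (tsrc A y)"
| tgt: "peq A (Suc m) x y \<Longrightarrow> peq A m (ttgt A x) (ttgt A y)"
| idn: "k < 3 \<Longrightarrow> peq A k x y \<Longrightarrow> peq A (Suc k) (Idn k x) (Idn k y)"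
| cmp: "k < m \<Longrightarrow> m \<le> 3 \<Longrightarrow> peq A m x x' \<Longrightarrow> peq A m y y' \<Longrightarrow>
    peq A k (tgt_to (raw A) k m x) (src_to (raw A) k m y) \<Longrightarrow>
    peq A m (Cmp m k y x) (Cmp m k y' x')"
| glob_src: "peq A (Suc (Suc m)) x x \<Longrightarrow> peq A m (tsrc A (tsrc A x)) (tsrc A (ttgt A x))"
| glob_tgt: "peq A (Suc (Suc m)) x x \<Longrightarrow> peq A m (ttgt A (tsrc A x)) (ttgt A (ttgt A x))"
| con: "k < 3 \<Longrightarrow> peq A k x x' \<Longrightarrow> peq A k y y' \<Longrightarrow>
    k = 0 \<or> (peq A (k - 1) (tsrc A x) (tsrc A y) \<and> peq A (k - 1) (ttgt A x) (ttgt A y)) \<Longrightarrow>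
    proj A x = proj A y \<Longrightarrow> peq A (Suc k) (Con k x y) (Con k x' y')"
| con_same: "k < 3 \<Longrightarrow> peq A k x x \<Longrightarrow> peq A (Suc k) (Con k x x) (Idn k x)"
| collapse: "peq A 3 x x \<Longrightarrow> peq A 3 y y \<Longrightarrow>
    peq A 2 (tsrc A x) (tsrc A y) \<Longrightarrow> peq A 2 (ttgt A x) (ttgt A y) \<Longrightarrow>
    proj A x = proj A y \<Longrightarrow> peq A 3 x y"

definition freeQ :: "'a glob \<Rightarrow> ('a trm set, 'a trm set) qobj" where
  "freeQ A =
     \<lparr>qX = term_magma A (peq A),
      qB = free_cat A,
      qf = (\<lambda>k X. proj A (rep X)),
      qc = (\<lambda>k X Y. cls (peq A) (Suc k) (Con k (rep X) (rep Y)))\<rparr>"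

definition N3 :: "'a glob \<Rightarrow> 'a trm set glob" where
  "N3 A = uglob (qX (freeQ A))"

definition N3_unit :: "'a glob \<Rightarrow> nat \<Rightarrow> 'a \<Rightarrow> 'a trm set" where
  "N3_unit A k a = cls (peq A) k (Gen k a)"

text \<open>The transpose under the adjunction of a globular map g from A to the underlying
  globular set of Q (its component on magmas).\<close>

definition N3_ext ::
  "('x, 'b) qobj \<Rightarrow> (nat \<Rightarrow> 'a \<Rightarrow> 'x) \<Rightarrow> nat \<Rightarrow> 'a trm set \<Rightarrow> 'x" where
  "N3_ext Q g k X = ev (qX Q) (qc Q) g (rep X)"

definition N3_map ::
  "'b glob \<Rightarrow> (nat \<Rightarrow> 'a \<Rightarrow> 'b) \<Rightarrow> nat \<Rightarrow> 'a trm set \<Rightarrow> 'b trm set" where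
  "N3_map B h = N3_ext (freeQ B) (\<lambda>k a. N3_unit B k (h k a))"

definition N3_mult :: "'a glob \<Rightarrow> nat \<Rightarrow> 'a trm set trm set \<Rightarrow> 'a trm set" where
  "N3_mult A = N3_ext (freeQ A) (\<lambda>k X. X)"

definition N3_algebra :: "'a glob \<Rightarrow> (nat \<Rightarrow> 'a trm set \<Rightarrow> 'a) \<Rightarrow> bool" where
  "N3_algebra A \<theta> \<longleftrightarrow> globular A \<and> glob_map (N3 A) A \<theta> \<and>
     (\<forall>k\<le>3. \<forall>a\<in>cells A k. \<theta> k (N3_unit A k a) = a) \<and>
     (\<forall>k\<le>3. \<forall>X\<in>cells (N3 (N3 A)) k. \<theta> k (N3_map A \<theta> k X) = \<theta> k (N3_mult A k X))"


section \<open>Generated 1-cells and the Eckmann-Hilton composites\<close>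

text \<open>The 1-cells generated by a set G of 1-cells.\<close>

inductive_set generated_1cells :: "('a, 'z) magma_scheme \<Rightarrow> 'a set \<Rightarrow> 'a set" for C G where
  gen: "f \<in> G \<Longrightarrow> f \<in> generated_1cells C G"
| idn: "x \<in> cells C 0 \<Longrightarrow> idn C 0 x \<in> generated_1cells C G"
| cmp: "f \<in> generated_1cells C G \<Longrightarrow> g \<in> generated_1cells C G \<Longrightarrow>
    tgt C 1 f = src C 1 g \<Longrightarrow> cmp C 1 0 g f \<in> generated_1cells C G"

abbreviation hcomp :: "('a, 'z) magma_scheme \<Rightarrow> 'a \<Rightarrow> 'a \<Rightarrow> 'a" where
  "hcomp C b a \<equiv> cmp C 2 0 b a"

abbreviation vcomp :: "('a, 'z) magma_scheme \<Rightarrow> 'a \<Rightarrow> 'a \<Rightarrow> 'a" where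
  "vcomp C b a \<equiv> cmp C 2 1 b a"

text \<open>The composites of the Eckmann-Hilton argument in cyclic order, with e in the role of
  the identity 2-cell.\<close>

definition eckmann_hilton :: "('a, 'z) magma_scheme \<Rightarrow> 'a \<Rightarrow> 'a \<Rightarrow> 'a \<Rightarrow> 'a list" where
  "eckmann_hilton C e a b =
     [hcomp C b a,
      hcomp C (vcomp C b e) (vcomp C e a),
      vcomp C (hcomp C b e) (hcomp C e a),
      vcomp C b a,
      vcomp C (hcomp C e b) (hcomp C a e),
      hcomp C (vcomp C e a) (vcomp C b e),
      hcomp C a b,
      hcomp C (vcomp C a e) (vcomp C e b),
      vcomp C (hcomp C a e) (hcomp C e b),
      vcomp C a b,
      vcomp C (hcomp C e a) (hcomp C b e),
      hcomp C (vcomp C e b) (vcomp C a e)]"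


section \<open>The constructions are free\<close>

text \<open>The results to note are the theorems \<open>free_cat_universal\<close>, \<open>free_cat_refl_universal\<close>,
  \<open>freeQ_object\<close> and \<open>N3_universal\<close>: \<open>free_cat\<close> and \<open>free_cat_refl\<close> are left adjoint to the
  forgetful functors from strict 3-categories, and \<open>freeQ\<close> is left adjoint to the forgetful
  functor from Q, with \<open>N3_ext\<close> as transpose; the type variables there are arbitrary.\<close>


lemma raw_simps[simp]: "src (raw A) k t = tsrc A t" "tgt (raw A) k t = ttgt A t"
  "idn (raw A) = Idn" "cmp (raw A) = Cmp"
  by (auto simp: raw_def)

lemma magma_refl: "is_magma M \<Longrightarrow> reflexive_globular M" by (simp add: is_magma_def)
lemma magma_glob: "is_magma M \<Longrightarrow> globular M" by (simp add: is_magma_def reflexive_globular_def)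
lemma strict_magma: "strict_3cat M \<Longrightarrow> is_magma M" by (simp add: strict_3cat_def)

lemma globD: assumes "globular A" "Suc m \<le> 3" "a \<in> cells A (Suc m)"
  shows "src A (Suc m) a \<in> cells A m" "tgt A (Suc m) a \<in> cells A m"
  using assms by (auto simp: globular_def)

lemma globD2: assumes "globular A" "Suc (Suc m) \<le> 3" "a \<in> cells A (Suc (Suc m))"
  shows "src A (Suc m) (src A (Suc (Suc m)) a) = src A (Suc m) (tgt A (Suc (Suc m)) a)"
   "tgt A (Suc m) (src A (Suc (Suc m)) a) = tgt A (Suc m) (tgt A (Suc (Suc m)) a)"
  using assms by (auto simp: globular_def)

lemma src_to_self[simp]: "src_to A m m a = a" by (cases m) auto
lemma tgt_to_self[simp]: "tgt_to A m m a = a" by (cases m) auto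

lemma bd_to_cells: assumes "globular A"
  shows "m \<le> 3 \<Longrightarrow> k \<le> m \<Longrightarrow> a \<in> cells A m \<Longrightarrow> src_to A k m a \<in> cells A k \<and> tgt_to A k m a \<in> cells A k"
  by (induction m arbitrary: a) (auto simp: le_Suc_eq simp: globD[OF assms])

lemma bd_to_bd: assumes "globular A" "m < 3" "k < m" "a \<in> cells A (Suc m)"
  shows "src_to A k m (tgt A (Suc m) a) = src_to A k m (src A (Suc m) a)"
    "tgt_to A k m (tgt A (Suc m) a) = tgt_to A k m (src A (Suc m) a)"
proof -
  obtain n where m: "m = Suc n" using assms(3) by (cases m) auto
  show "src_to A k m (tgt A (Suc m) a) = src_to A k m (src A (Suc m) a)"
    "tgt_to A k m (tgt A (Suc m) a) = tgt_to A k m (src A (Suc m) a)"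
    using assms globD2[OF assms(1), of n a] unfolding m by auto
qed

lemma magmaD:
  assumes "is_magma M" "k \<le> m" "m < 3" "x \<in> cells M (Suc m)" "y \<in> cells M (Suc m)"
    "tgt_to M k (Suc m) x = src_to M k (Suc m) y"
  shows "cmp M (Suc m) k y x \<in> cells M (Suc m)"
    "src M (Suc m) (cmp M (Suc m) k y x) = (if k = m then src M (Suc m) x
              else cmp M m k (src M (Suc m) y) (src M (Suc m) x))"
    "tgt M (Suc m) (cmp M (Suc m) k y x) = (if k = m then tgt M (Suc m) y
              else cmp M m k (tgt M (Suc m) y) (tgt M (Suc m) x))"
  using assms(1)[unfolded is_magma_def, THEN conjunct2, rule_format, of k m x y] assms(2-) by simp_all

lemma magma_cmp_cell: assumes "is_magma M" "k < m" "m \<le> 3" "x \<in> cells M m" "y \<in> cells M m"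
    "tgt_to M k m x = src_to M k m y"
  shows "cmp M m k y x \<in> cells M m"
proof -
  obtain n where "m = Suc n" using assms by (cases m) auto
  then show ?thesis using magmaD(1)[of M k n x y] assms by auto
qed

lemma idnD: assumes "is_magma M" "k < 3" "a \<in> cells M k"
  shows "idn M k a \<in> cells M (Suc k)" "src M (Suc k) (idn M k a) = a" "tgt M (Suc k) (idn M k a) = a"
  using assms by (auto simp: is_magma_def reflexive_globular_def)

primrec good :: "'a glob \<Rightarrow> 'x magma \<Rightarrow> (nat \<Rightarrow> 'x \<Rightarrow> 'x \<Rightarrow> 'x) \<Rightarrow> (nat \<Rightarrow> 'a \<Rightarrow> 'x) \<Rightarrow>
    nat \<Rightarrow> 'a trm \<Rightarrow> bool" where
  "good A M c g 0 t \<longleftrightarrow> ev M c g t \<in> cells M 0"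
| "good A M c g (Suc m) t \<longleftrightarrow> ev M c g t \<in> cells M (Suc m) \<and>
     ev M c g (tsrc A t) = src M (Suc m) (ev M c g t) \<and>
     ev M c g (ttgt A t) = tgt M (Suc m) (ev M c g t) \<and>
     good A M c g m (tsrc A t) \<and> good A M c g m (ttgt A t)"

lemma good_cell: "good A M c g m t \<Longrightarrow> ev M c g t \<in> cells M m" by (cases m) auto

lemma good_to: "good A M c g m t \<Longrightarrow> k \<le> m \<Longrightarrow>
    ev M c g (src_to (raw A) k m t) = src_to M k m (ev M c g t) \<and> good A M c g k (src_to (raw A) k m t) \<and>
    ev M c g (tgt_to (raw A) k m t) = tgt_to M k m (ev M c g t) \<and> good A M c g k (tgt_to (raw A) k m t)"
proof (induction m arbitrary: t)
  case (Suc m)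
  show ?case
  proof (cases "k \<le> m")
    case True
    then show ?thesis using Suc.IH[of "tsrc A t"] Suc.IH[of "ttgt A t"] Suc.prems by simp
  next
    case False
    then have "k = Suc m" using Suc.prems by simp
    then show ?thesis using Suc.prems by simp
  qed
qed auto

lemma good_idn: assumes "is_magma M" "k < 3" "good A M c g k t"
  shows "good A M c g (Suc k) (Idn k t)"
  using assms idnD[OF assms(1,2) good_cell[OF assms(3)]] by simp

lemma good_idn_to: assumes "is_magma M" "good A M c g k t"
  shows "k \<le> m \<Longrightarrow> m \<le> 3 \<Longrightarrow> good A M c g m (idn_to (raw A) k m t) \<and>
     ev M c g (idn_to (raw A) k m t) = idn_to M k m (ev M c g t)"
proof (induction m)
  case (Suc m)
  show ?case
  proof (cases "k \<le> m")
    case True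
    then have IH: "good A M c g m (idn_to (raw A) k m t) \<and>
     ev M c g (idn_to (raw A) k m t) = idn_to M k m (ev M c g t)" using Suc by simp
    have "good A M c g (Suc m) (Idn m (idn_to (raw A) k m t))"
      using IH Suc.prems by (intro good_idn[OF assms(1)]) auto
    then show ?thesis using True IH by (simp del: good.simps)
  next
    case False
    then have "k = Suc m" using Suc.prems by simp
    then show ?thesis using assms by simp
  qed
qed (use assms in auto)

lemma good_cmp: assumes M: "is_magma M"
  shows "k < m \<Longrightarrow> m \<le> 3 \<Longrightarrow> good A M c g m x \<Longrightarrow> good A M c g m y \<Longrightarrow>
    tgt_to M k m (ev M c g x) = src_to M k m (ev M c g y) \<Longrightarrow> good A M c g m (Cmp m k y x)"
proof (induction m arbitrary: x y)
  case (Suc m)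
  note d = magmaD[OF M, of k m "ev M c g x" "ev M c g y"]
  have cx: "ev M c g x \<in> cells M (Suc m)" and cy: "ev M c g y \<in> cells M (Suc m)"
    using Suc.prems by auto
  show ?case
  proof (cases "k = m")
    case True
    then show ?thesis using Suc.prems d cx cy by auto
  next
    case False
    then have k: "k < m" using Suc.prems by simp
    note b = bd_to_bd[OF magma_glob[OF M] _ k, of "ev M c g x"] bd_to_bd[OF magma_glob[OF M] _ k, of "ev M c g y"]
    have "good A M c g m (Cmp m k (tsrc A y) (tsrc A x))"
      using Suc.prems k b cx cy by (intro Suc.IH) auto
    moreover have "good A M c g m (Cmp m k (ttgt A y) (ttgt A x))"
      using Suc.prems k b cx cy by (intro Suc.IH) auto
    ultimately show ?thesis using Suc.prems d cx cy k by auto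
  qed
qed auto

lemma good_gen: assumes "globular A" "glob_map A M g"
  shows "k \<le> 3 \<Longrightarrow> a \<in> cells A k \<Longrightarrow> good A M c g k (Gen k a)"
proof (induction k arbitrary: a)
  case 0 then show ?case using assms by (auto simp: glob_map_def)
next
  case (Suc k) then show ?case using assms globD[OF assms(1)] by (auto simp: glob_map_def)
qed

lemma good_con: assumes M: "is_magma M" and "k < 3" "good A M c g k x" "good A M c g k y"
  "c k (ev M c g x) (ev M c g y) \<in> cells M (Suc k)"
  "src M (Suc k) (c k (ev M c g x) (ev M c g y)) = ev M c g x"
  "tgt M (Suc k) (c k (ev M c g x) (ev M c g y)) = ev M c g y"
  shows "good A M c g (Suc k) (Con k x y)"
  using assms by auto

lemma strictD: assumes "strict_3cat M"
  shows "\<And>m k x y z. k < m \<Longrightarrow> m \<le> 3 \<Longrightarrow> x \<in> cells M m \<Longrightarrow> y \<in> cells M m \<Longrightarrow> z \<in> cells M m \<Longrightarrow>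
         tgt_to M k m x = src_to M k m y \<Longrightarrow> tgt_to M k m y = src_to M k m z \<Longrightarrow>
           cmp M m k (cmp M m k z y) x = cmp M m k z (cmp M m k y x)"
  "\<And>m k x. k < m \<Longrightarrow> m \<le> 3 \<Longrightarrow> x \<in> cells M m \<Longrightarrow> cmp M m k x (idn_to M k m (src_to M k m x)) = x"
  "\<And>m k x. k < m \<Longrightarrow> m \<le> 3 \<Longrightarrow> x \<in> cells M m \<Longrightarrow> cmp M m k (idn_to M k m (tgt_to M k m x)) x = x"
  "\<And>m l k x y z w. k < l \<Longrightarrow> l < m \<Longrightarrow> m \<le> 3 \<Longrightarrow>
       x\<in>cells M m \<Longrightarrow> y\<in>cells M m \<Longrightarrow> z\<in>cells M m \<Longrightarrow> w\<in>cells M m \<Longrightarrow>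
         tgt_to M l m x = src_to M l m y \<Longrightarrow> tgt_to M l m z = src_to M l m w \<Longrightarrow>
         tgt_to M k m x = src_to M k m z \<Longrightarrow>
           cmp M m k (cmp M m l w z) (cmp M m l y x) =
           cmp M m l (cmp M m k w y) (cmp M m k z x)"
  "\<And>m k x y. k < m \<Longrightarrow> m < 3 \<Longrightarrow> x\<in>cells M m \<Longrightarrow> y\<in>cells M m \<Longrightarrow>
         tgt_to M k m x = src_to M k m y \<Longrightarrow>
           cmp M (Suc m) k (idn M m y) (idn M m x) = idn M m (cmp M m k y x)"
proof -
  note d = assms[unfolded strict_3cat_def]
  note c2 = d[THEN conjunct2] note c3 = c2[THEN conjunct2] note c4 = c3[THEN conjunct2]
  note a = c2[THEN conjunct1, rule_format] and u = c3[THEN conjunct1, rule_format]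
    and i = c4[THEN conjunct1, rule_format] and f = c4[THEN conjunct2, rule_format]
  fix m l k x y z w
  show "k < m \<Longrightarrow> m \<le> 3 \<Longrightarrow> x \<in> cells M m \<Longrightarrow> y \<in> cells M m \<Longrightarrow> z \<in> cells M m \<Longrightarrow>
         tgt_to M k m x = src_to M k m y \<Longrightarrow> tgt_to M k m y = src_to M k m z \<Longrightarrow>
           cmp M m k (cmp M m k z y) x = cmp M m k z (cmp M m k y x)" by (rule a) simp_all
  show "k < m \<Longrightarrow> m \<le> 3 \<Longrightarrow> x \<in> cells M m \<Longrightarrow> cmp M m k x (idn_to M k m (src_to M k m x)) = x"
    by (rule u[THEN conjunct1]) simp_all
  show "k < m \<Longrightarrow> m \<le> 3 \<Longrightarrow> x \<in> cells M m \<Longrightarrow> cmp M m k (idn_to M k m (tgt_to M k m x)) x = x"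
    by (rule u[THEN conjunct2]) simp_all
  show "k < l \<Longrightarrow> l < m \<Longrightarrow> m \<le> 3 \<Longrightarrow>
       x\<in>cells M m \<Longrightarrow> y\<in>cells M m \<Longrightarrow> z\<in>cells M m \<Longrightarrow> w\<in>cells M m \<Longrightarrow>
         tgt_to M l m x = src_to M l m y \<Longrightarrow> tgt_to M l m z = src_to M l m w \<Longrightarrow>
         tgt_to M k m x = src_to M k m z \<Longrightarrow>
           cmp M m k (cmp M m l w z) (cmp M m l y x) =
           cmp M m l (cmp M m k w y) (cmp M m k z x)" by (rule i) simp_all
  show "k < m \<Longrightarrow> m < 3 \<Longrightarrow> x\<in>cells M m \<Longrightarrow> y\<in>cells M m \<Longrightarrow>
         tgt_to M k m x = src_to M k m y \<Longrightarrow>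
           cmp M (Suc m) k (idn M m y) (idn M m x) = idn M m (cmp M m k y x)" by (rule f) simp_all
qed

lemma to_Suc: "k \<le> m \<Longrightarrow> src_to A k (Suc m) x = src_to A k m (src A (Suc m) x)"
  "k \<le> m \<Longrightarrow> tgt_to A k (Suc m) x = tgt_to A k m (tgt A (Suc m) x)" by auto

lemma cmp_to: assumes M: "is_magma M"
  shows "k < m \<Longrightarrow> m \<le> 3 \<Longrightarrow> x \<in> cells M m \<Longrightarrow> y \<in> cells M m \<Longrightarrow>
   tgt_to M k m x = src_to M k m y \<Longrightarrow> l \<le> m \<Longrightarrow>
   src_to M l m (cmp M m k y x) = (if l \<le> k then src_to M l m x else cmp M l k (src_to M l m y) (src_to M l m x)) \<and>
   tgt_to M l m (cmp M m k y x) = (if l \<le> k then tgt_to M l m y else cmp M l k (tgt_to M l m y) (tgt_to M l m x))"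
proof (induction m arbitrary: x y)
  case (Suc m)
  note d = magmaD[OF M, of k m x y]
  show ?case
  proof (cases "l = Suc m")
    case True then show ?thesis using Suc.prems by simp
  next
    case False
    then have l: "l \<le> m" using Suc.prems by simp
    show ?thesis
    proof (cases "k = m")
      case True then show ?thesis using l d Suc.prems by auto
    next
      case False
      then have k: "k < m" using Suc.prems by simp
      note b = bd_to_bd[OF magma_glob[OF M] _ k, of x] bd_to_bd[OF magma_glob[OF M] _ k, of y]
      note c = globD[OF magma_glob[OF M] Suc.prems(2), of x] globD[OF magma_glob[OF M] Suc.prems(2), of y]
      show ?thesis using l d Suc.prems k b c
          Suc.IH[of "src M (Suc m) x" "src M (Suc m) y"] Suc.IH[of "tgt M (Suc m) x" "tgt M (Suc m) y"]
        by (auto simp: to_Suc simp del: src_to.simps tgt_to.simps)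
    qed
  qed
qed auto

lemma idn_to_props: assumes M: "is_magma M" and "a \<in> cells M k"
  shows "k \<le> m \<Longrightarrow> m \<le> 3 \<Longrightarrow> idn_to M k m a \<in> cells M m \<and> src_to M k m (idn_to M k m a) = a \<and>
    tgt_to M k m (idn_to M k m a) = a"
proof (induction m)
  case (Suc m)
  show ?case
  proof (cases "k = Suc m")
    case False
    then show ?thesis using Suc idnD[OF M, of m "idn_to M k m a"] by auto
  qed (use assms in auto)
qed (use assms in auto)

lemma to_to: assumes G: "globular M" 
  shows "j < k \<Longrightarrow> k \<le> m \<Longrightarrow> m \<le> 3 \<Longrightarrow> x \<in> cells M m \<Longrightarrow>
    src_to M j k (src_to M k m x) = src_to M j m x \<and> src_to M j k (tgt_to M k m x) = src_to M j m x \<and>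
    tgt_to M j k (src_to M k m x) = tgt_to M j m x \<and> tgt_to M j k (tgt_to M k m x) = tgt_to M j m x"
proof (induction m arbitrary: x)
  case (Suc m)
  show ?case
  proof (cases "k = Suc m")
    case True then show ?thesis by simp
  next
    case False
    then have "k \<le> m" "j < m" using Suc.prems by auto
    then show ?thesis using Suc.prems bd_to_bd[OF G, of m j x] globD[OF G Suc.prems(3), of x]
       Suc.IH[of "src M (Suc m) x"] Suc.IH[of "tgt M (Suc m) x"] by auto
  qed
qed auto

lemma interchange_comp:
  assumes M: "is_magma M" and kl: "k < l" "l < m" "m \<le> 3" and c: "x \<in> cells M m" "y \<in> cells M m" "z \<in> cells M m" "w \<in> cells M m"
   and e: "tgt_to M l m x = src_to M l m y" "tgt_to M l m z = src_to M l m w" "tgt_to M k m x = src_to M k m z"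
  shows "tgt_to M k m (cmp M m l y x) = src_to M k m (cmp M m l w z)"
   "tgt_to M k m y = src_to M k m w"
   "tgt_to M l m (cmp M m k z x) = src_to M l m (cmp M m k w y)"
proof -
  note G = magma_glob[OF M]
  have 1: "tgt_to M k m y = tgt_to M k m x"
    using to_to[OF G, of k l m y] to_to[OF G, of k l m x] kl c e by auto
  have 2: "src_to M k m z = src_to M k m w"
    using to_to[OF G, of k l m z] to_to[OF G, of k l m w] kl c e by auto
  show 3: "tgt_to M k m y = src_to M k m w" using 1 2 e by simp
  show "tgt_to M k m (cmp M m l y x) = src_to M k m (cmp M m l w z)"
    using cmp_to[OF M, of l m x y k] cmp_to[OF M, of l m z w k] kl c e 2 3 by auto
  show "tgt_to M l m (cmp M m k z x) = src_to M l m (cmp M m k w y)"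
    using cmp_to[OF M, of k m x z l] cmp_to[OF M, of k m y w l] kl c e 3 by auto
qed

lemma teq_sound:
  assumes A: "globular A" and B: "strict_3cat B" and g: "glob_map A B g"
    and I: "\<And>k a b. (k,a,b) \<in> I \<Longrightarrow> k < 3 \<Longrightarrow> a \<in> cells A k \<Longrightarrow> b \<in> cells A (Suc k) \<Longrightarrow> g (Suc k) b = idn B k (g k a)"
  shows "teq A I m x y \<Longrightarrow> m \<le> 3 \<and> good A B c g m x \<and> good A B c g m y \<and> ev B c g x = ev B c g y"
proof (induction rule: teq.induct)
  note M = strict_magma[OF B]
  note G = magma_glob[OF M]
  {
    case gen then show ?case using good_gen[OF A g] by auto
  next
    case (gen_idn k a b)
    have "good A B c g k (Gen k a)" "good A B c g (Suc k) (Gen (Suc k) b)"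
      using gen_idn by (auto intro!: good_gen[OF A g] simp del: good.simps)
    then show ?case using good_idn[OF M, of k A c g "Gen k a"] I[OF gen_idn(2,1,3,4)] gen_idn(1) by (simp del: good.simps)
  next
    case sym then show ?case by simp
  next
    case trans then show ?case by simp
  next
    case src then show ?case by simp
  next
    case tgt then show ?case by simp
  next
    case idn then show ?case using good_idn[OF M] by (auto simp del: good.simps)
  next
    case (cmp k m x x' y y')
    then have gd: "good A B c g m x" "good A B c g m y" "good A B c g m x'" "good A B c g m y'"
       "ev B c g x' = ev B c g x" "ev B c g y' = ev B c g y" by auto
    have "tgt_to B k m (ev B c g x) = src_to B k m (ev B c g y)"
      using cmp good_to[OF gd(1), of k] good_to[OF gd(2), of k] by auto
    then show ?case using gd cmp(1,2) by (auto intro!: good_cmp[OF M])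
  next
    case (glob_src m x)
    then show ?case using globD2[OF G, of m "ev B c g x"] by auto
  next
    case (glob_tgt m x)
    then show ?case using globD2[OF G, of m "ev B c g x"] by auto
  next
    case (assoc k m x y z)
    have *: "good A B c g m x" "good A B c g m y" "good A B c g m z"
      "tgt_to B k m (ev B c g x) = src_to B k m (ev B c g y)"
      "tgt_to B k m (ev B c g y) = src_to B k m (ev B c g z)"
      using assoc good_to[of A B c g m x k] good_to[of A B c g m y k] good_to[of A B c g m z k] by auto
    note cc = *(1)[THEN good_cell] *(2)[THEN good_cell] *(3)[THEN good_cell]
    have 1: "good A B c g m (Cmp m k z y)" "good A B c g m (Cmp m k y x)"
      using * assoc(1,2) by (auto intro!: good_cmp[OF M])
    then have "good A B c g m (Cmp m k (Cmp m k z y) x)" "good A B c g m (Cmp m k z (Cmp m k y x))"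
      using * assoc(1,2) cmp_to[OF M, of k m "ev B c g y" "ev B c g z" k] cmp_to[OF M, of k m "ev B c g x" "ev B c g y" k] cc
      by (auto intro!: good_cmp[OF M])
    then show ?case using * assoc(1,2) strictD(1)[OF B] cc by auto
  next
    case (unit_src k m x)
    have x: "good A B c g m x" using unit_src by simp
    note t = good_to[OF x, of k]
    have i: "good A B c g m (idn_to (raw A) k m (src_to (raw A) k m x)) \<and>
      ev B c g (idn_to (raw A) k m (src_to (raw A) k m x)) = idn_to B k m (src_to B k m (ev B c g x))"
      using good_idn_to[OF M, of A c g k "src_to (raw A) k m x" m] unit_src t by auto
    have "src_to B k m (ev B c g x) \<in> cells B k" using bd_to_cells[OF G, of m k] good_cell[OF x] unit_src by auto
    then show ?case using i x unit_src idn_to_props[OF M, of _ k m] strictD(2)[OF B unit_src(1,2) good_cell[OF x]]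
      by (auto intro!: good_cmp[OF M])
  next
    case (unit_tgt k m x)
    have x: "good A B c g m x" using unit_tgt by simp
    note t = good_to[OF x, of k]
    have i: "good A B c g m (idn_to (raw A) k m (tgt_to (raw A) k m x)) \<and>
      ev B c g (idn_to (raw A) k m (tgt_to (raw A) k m x)) = idn_to B k m (tgt_to B k m (ev B c g x))"
      using good_idn_to[OF M, of A c g k "tgt_to (raw A) k m x" m] unit_tgt t by auto
    have "tgt_to B k m (ev B c g x) \<in> cells B k" using bd_to_cells[OF G, of m k] good_cell[OF x] unit_tgt by auto
    then show ?case using i x unit_tgt idn_to_props[OF M, of _ k m] strictD(3)[OF B unit_tgt(1,2) good_cell[OF x]]
      by (auto intro!: good_cmp[OF M])
  next
    case (interchange k l m x y z w)
    have gd: "good A B c g m x" "good A B c g m y" "good A B c g m z" "good A B c g m w" using interchange by auto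
    note cc = gd[THEN good_cell]
    have kl: "k < l" "l < m" "m \<le> 3" "k < m" using interchange by auto
    have e: "tgt_to B l m (ev B c g x) = src_to B l m (ev B c g y)" "tgt_to B l m (ev B c g z) = src_to B l m (ev B c g w)" "tgt_to B k m (ev B c g x) = src_to B k m (ev B c g z)"
      using interchange kl gd[THEN good_to, of k] gd[THEN good_to, of l] by auto
    note ic = interchange_comp[OF M kl(1-3) cc e]
    have "good A B c g m (Cmp m l w z)" "good A B c g m (Cmp m l y x)" "good A B c g m (Cmp m k w y)" "good A B c g m (Cmp m k z x)"
      using gd kl e ic by (auto intro!: good_cmp[OF M])
    then show ?case using kl ic strictD(4)[OF B kl(1-3) cc e] by (auto intro!: good_cmp[OF M])
  next
    case (idn_cmp k m x y)
    have gd: "good A B c g m x" "good A B c g m y" using idn_cmp by auto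
    note cc = gd[THEN good_cell]
    have km: "k < m" "m < 3" using idn_cmp by auto
    have e: "tgt_to B k m (ev B c g x) = src_to B k m (ev B c g y)" 
      using idn_cmp gd[THEN good_to, of k] by auto
    have gi: "good A B c g (Suc m) (Idn m x)" "good A B c g (Suc m) (Idn m y)"
      using km gd by (auto intro!: good_idn[OF M] simp del: good.simps)
    have "good A B c g (Suc m) (Idn m (Cmp m k y x))"
      using km gd e by (intro good_idn[OF M] good_cmp[OF M]) auto
    moreover have "good A B c g (Suc m) (Cmp (Suc m) k (Idn m y) (Idn m x))"
      using km e idnD[OF M km(2)] cc by (intro good_cmp[OF M] gi) auto
    ultimately show ?case using km strictD(5)[OF B km cc e] by (auto simp del: good.simps)
  }
qed

locale pcong =
  fixes A :: "'a glob" and E :: "nat \<Rightarrow> 'a trm \<Rightarrow> 'a trm \<Rightarrow> bool"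
  assumes sym: "E m x y \<Longrightarrow> E m y x"
   and trans: "E m x y \<Longrightarrow> E m y z \<Longrightarrow> E m x z"
   and le3: "E m x y \<Longrightarrow> m \<le> 3"
   and src: "E (Suc m) x y \<Longrightarrow> E m (tsrc A x) (tsrc A y)"
   and tgt: "E (Suc m) x y \<Longrightarrow> E m (ttgt A x) (ttgt A y)"
   and idn: "k < 3 \<Longrightarrow> E k x y \<Longrightarrow> E (Suc k) (Idn k x) (Idn k y)"
   and cmp: "k < m \<Longrightarrow> m \<le> 3 \<Longrightarrow> E m x x' \<Longrightarrow> E m y y' \<Longrightarrow>
     E k (tgt_to (raw A) k m x) (src_to (raw A) k m y) \<Longrightarrow> E m (Cmp m k y x) (Cmp m k y' x')"
   and glob_src: "E (Suc (Suc m)) x x \<Longrightarrow> E m (tsrc A (tsrc A x)) (tsrc A (ttgt A x))"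
   and glob_tgt: "E (Suc (Suc m)) x x \<Longrightarrow> E m (ttgt A (tsrc A x)) (ttgt A (ttgt A x))"
begin

abbreviation "Q \<equiv> term_magma A E"

lemma l: "E m x y \<Longrightarrow> E m x x" by (rule trans[OF _ sym])
lemma r: "E m x y \<Longrightarrow> E m y y" by (rule trans[OF sym])

lemma cls_eq: assumes "E m x x" shows "cls E m x = cls E m y \<longleftrightarrow> E m x y"
proof
  assume "cls E m x = cls E m y"
  then have "E m y x" using assms unfolding cls_def by blast
  then show "E m x y" by (rule sym)
next
  assume a: "E m x y"
  show "cls E m x = cls E m y" unfolding cls_def
    by (intro Collect_cong iffI) (erule trans[OF sym[OF a]], erule trans[OF a])
qed

lemma rep_cls: assumes "E m x x" shows "E m x (rep (cls E m x))"
proof -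
  have "x \<in> cls E m x" using assms by (simp add: cls_def)
  then have "rep (cls E m x) \<in> cls E m x" unfolding rep_def by (rule someI)
  then show ?thesis by (simp add: cls_def)
qed

lemma cellI: "E m x x \<Longrightarrow> cls E m x \<in> cells Q m" by (auto simp: term_magma_def)
lemma cellE: "X \<in> cells Q m \<Longrightarrow> (\<And>x. E m x x \<Longrightarrow> X = cls E m x \<Longrightarrow> P) \<Longrightarrow> P"
  by (auto simp: term_magma_def)

lemma Qsrc: assumes "E (Suc m) x x" shows "src Q (Suc m) (cls E (Suc m) x) = cls E m (tsrc A x)"
  using src[OF rep_cls[OF assms]] by (simp add: term_magma_def) (metis cls_eq l)
lemma Qtgt: assumes "E (Suc m) x x" shows "tgt Q (Suc m) (cls E (Suc m) x) = cls E m (ttgt A x)"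
  using tgt[OF rep_cls[OF assms]] by (simp add: term_magma_def) (metis cls_eq l)
lemma Qidn: assumes "k < 3" "E k x x" shows "idn Q k (cls E k x) = cls E (Suc k) (Idn k x)"
  using idn[OF assms(1) rep_cls[OF assms(2)]] by (simp add: term_magma_def) (metis cls_eq l)

lemma src_to_E: "k \<le> m \<Longrightarrow> E m x y \<Longrightarrow> E k (src_to (raw A) k m x) (src_to (raw A) k m y)"
  by (induction m arbitrary: x y) (auto simp: le_Suc_eq intro: src)
lemma tgt_to_E: "k \<le> m \<Longrightarrow> E m x y \<Longrightarrow> E k (tgt_to (raw A) k m x) (tgt_to (raw A) k m y)"
  by (induction m arbitrary: x y) (auto simp: le_Suc_eq intro: tgt)

lemma Qsrc_to: "k \<le> m \<Longrightarrow> E m x x \<Longrightarrow> src_to Q k m (cls E m x) = cls E k (src_to (raw A) k m x)"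
proof (induction m arbitrary: x)
  case (Suc m) then show ?case using Qsrc[OF Suc.prems(2)] src[OF Suc.prems(2)] by (auto simp: le_Suc_eq)
qed auto
lemma Qtgt_to: "k \<le> m \<Longrightarrow> E m x x \<Longrightarrow> tgt_to Q k m (cls E m x) = cls E k (tgt_to (raw A) k m x)"
proof (induction m arbitrary: x)
  case (Suc m) then show ?case using Qtgt[OF Suc.prems(2)] tgt[OF Suc.prems(2)] by (auto simp: le_Suc_eq)
qed auto

lemma Qcomp: assumes "k \<le> m" "E m x x" "E m y y"
  shows "tgt_to Q k m (cls E m x) = src_to Q k m (cls E m y) \<longleftrightarrow> E k (tgt_to (raw A) k m x) (src_to (raw A) k m y)"
  using assms by (simp add: Qsrc_to Qtgt_to cls_eq tgt_to_E)

lemma Qcmp: assumes "k < m" "m \<le> 3" "E m x x" "E m y y" "E k (tgt_to (raw A) k m x) (src_to (raw A) k m y)"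
  shows "cmp Q m k (cls E m y) (cls E m x) = cls E m (Cmp m k y x)"
  using cmp[OF assms(1,2) rep_cls[OF assms(3)] rep_cls[OF assms(4)] assms(5)]
  by (simp add: term_magma_def) (metis cls_eq l)

lemma Qidn_to: "k \<le> m \<Longrightarrow> m \<le> 3 \<Longrightarrow> E k x x \<Longrightarrow> idn_to Q k m (cls E k x) = cls E m (idn_to (raw A) k m x) \<and>
   E m (idn_to (raw A) k m x) (idn_to (raw A) k m x)"
proof (induction m)
  case (Suc m)
  show ?case
  proof (cases "k = Suc m")
    case False then show ?thesis using Suc Qidn[of m] idn[of m] by auto
  qed (use Suc in auto)
qed auto

lemma cells0: "3 < m \<Longrightarrow> cells Q m = {}" using le3 by (fastforce elim: cellE)

lemma Qglob: "globular Q"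
  unfolding globular_def
proof (intro conjI allI impI ballI)
  fix k X assume "X \<in> cells Q (Suc k)"
  then obtain x where x: "E (Suc k) x x" "X = cls E (Suc k) x" by (rule cellE)
  show "src Q (Suc k) X \<in> cells Q k" "tgt Q (Suc k) X \<in> cells Q k"
    using x src[OF x(1)] tgt[OF x(1)] by (simp_all add: Qsrc Qtgt cellI)
next
  fix k X assume "X \<in> cells Q (Suc (Suc k))"
  then obtain x where x: "E (Suc (Suc k)) x x" "X = cls E (Suc (Suc k)) x" by (rule cellE)
  note s = src[OF x(1)] tgt[OF x(1)]
  note ss = s[THEN src] s[THEN tgt]
  show "src Q (Suc k) (src Q (Suc (Suc k)) X) = src Q (Suc k) (tgt Q (Suc (Suc k)) X)"
   "tgt Q (Suc k) (src Q (Suc (Suc k)) X) = tgt Q (Suc k) (tgt Q (Suc (Suc k)) X)"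
    using s ss x glob_src[OF x(1)] glob_tgt[OF x(1)] by (simp_all add: Qsrc Qtgt cls_eq)
qed

lemma Qmagma: "is_magma Q"
proof -
  have "reflexive_globular Q" unfolding reflexive_globular_def
    using Qglob by (auto elim!: cellE simp: Qidn Qsrc Qtgt idn intro!: cellI)
  moreover have "cmp Q (Suc m) k Y X \<in> cells Q (Suc m) \<and>
           src Q (Suc m) (cmp Q (Suc m) k Y X) =
             (if k = m then src Q (Suc m) X
              else cmp Q m k (src Q (Suc m) Y) (src Q (Suc m) X)) \<and>
           tgt Q (Suc m) (cmp Q (Suc m) k Y X) =
             (if k = m then tgt Q (Suc m) Y
              else cmp Q m k (tgt Q (Suc m) Y) (tgt Q (Suc m) X))"
    if km: "k \<le> m" "m < 3" and c: "X \<in> cells Q (Suc m)" "Y \<in> cells Q (Suc m)" 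
      and e: "tgt_to Q k (Suc m) X = src_to Q k (Suc m) Y" for k m X Y
  proof -
    obtain x y where x: "E (Suc m) x x" "X = cls E (Suc m) x" and y: "E (Suc m) y y" "Y = cls E (Suc m) y"
      using c by (auto elim!: cellE)
    have ee: "E k (tgt_to (raw A) k (Suc m) x) (src_to (raw A) k (Suc m) y)"
      using Qcomp[of k "Suc m" x y] e x y km by auto
    have w: "E (Suc m) (Cmp (Suc m) k y x) (Cmp (Suc m) k y x)"
      using cmp[of k "Suc m"] x y ee km by auto
    note q = Qcmp[of k "Suc m" x y]
    show ?thesis
    proof (cases "k = m")
      case True
      then show ?thesis using q x y ee km w by (auto simp: Qsrc Qtgt intro: cellI)
    next
      case False
      then have k: "k < m" using km by simp
      have s: "tgt_to Q k m (src Q (Suc m) X) = src_to Q k m (src Q (Suc m) Y)"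
        using e k bd_to_bd[OF Qglob _ k, of X] km c by auto
      have t: "tgt_to Q k m (tgt Q (Suc m) X) = src_to Q k m (tgt Q (Suc m) Y)"
        using e k bd_to_bd[OF Qglob _ k, of Y] km c by auto
      have s': "E k (tgt_to (raw A) k m (tsrc A x)) (src_to (raw A) k m (tsrc A y))"
        using s x y k by (simp add: Qsrc Qcomp src)
      have t': "E k (tgt_to (raw A) k m (ttgt A x)) (src_to (raw A) k m (ttgt A y))"
        using t x y k by (simp add: Qtgt Qcomp tgt)
      show ?thesis using q x y ee km k w s' t' 
        by (auto simp: Qsrc Qtgt Qcmp src tgt intro: cellI)
    qed
  qed
  ultimately show ?thesis unfolding is_magma_def by blast
qed

end

lemma teq_le3: "teq A I m x y \<Longrightarrow> m \<le> 3"
  by (induction rule: teq.induct) auto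
lemma peq_le3: "peq A m x y \<Longrightarrow> m \<le> 3"
  by (induction rule: peq.induct) auto

interpretation T: pcong A "teq A I" for A I
  by unfold_locales (blast intro: teq.intros teq_le3)+
interpretation P: pcong A "peq A" for A
  by unfold_locales (blast intro: peq.intros peq_le3)+


theorem term_strict: "strict_3cat (term_magma A (teq A I))" (is "strict_3cat ?Q")
  unfolding strict_3cat_def
proof (intro conjI allI impI ballI; (elim conjE)?)
  note M = T.Qmagma[of A I]
  show "is_magma ?Q" by (rule M)
  {
    fix m k X Y Z assume km: "k < m" "m \<le> 3" and c: "X \<in> cells ?Q m" "Y \<in> cells ?Q m" "Z \<in> cells ?Q m"
     and e: "tgt_to ?Q k m X = src_to ?Q k m Y" "tgt_to ?Q k m Y = src_to ?Q k m Z"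
    obtain x y z where x: "teq A I m x x" "X = cls (teq A I) m x" and y: "teq A I m y y" "Y = cls (teq A I) m y"
      and z: "teq A I m z z" "Z = cls (teq A I) m z" using c by (auto elim!: T.cellE)
    have e': "teq A I k (tgt_to (raw A) k m x) (src_to (raw A) k m y)" "teq A I k (tgt_to (raw A) k m y) (src_to (raw A) k m z)"
      using e x y z km by (auto simp: T.Qcomp)
    note a = teq.assoc[OF km x(1) y(1) z(1) e']
    have yx: "teq A I m (Cmp m k y x) (Cmp m k y x)" and zy: "teq A I m (Cmp m k z y) (Cmp m k z y)"
      using km x y z e' by (auto intro: teq.cmp)
    have "tgt_to ?Q k m (cmp ?Q m k Y X) = src_to ?Q k m Z" "tgt_to ?Q k m X = src_to ?Q k m (cmp ?Q m k Z Y)"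
      using cmp_to[OF M, of k m X Y k] cmp_to[OF M, of k m Y Z k] km c e by auto
    then have "teq A I k (tgt_to (raw A) k m x) (src_to (raw A) k m (Cmp m k z y))" "teq A I k (tgt_to (raw A) k m (Cmp m k y x)) (src_to (raw A) k m z)"
      using x y z km e' yx zy by (auto simp: T.Qcmp T.Qcomp)
    then show "cmp ?Q m k (cmp ?Q m k Z Y) X = cmp ?Q m k Z (cmp ?Q m k Y X)"
      using x y z km e' yx zy a by (simp add: T.Qcmp) (meson T.cls_eq T.l)
  }
  {
    fix m k X assume km: "k < m" "m \<le> 3" and c: "X \<in> cells ?Q m"
    obtain x where x: "teq A I m x x" "X = cls (teq A I) m x" using c by (auto elim!: T.cellE)
    have s: "teq A I k (src_to (raw A) k m x) (src_to (raw A) k m x)" "teq A I k (tgt_to (raw A) k m x) (tgt_to (raw A) k m x)"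
      using km x by (auto intro: T.src_to_E T.tgt_to_E)
    have cs: "src_to ?Q k m X \<in> cells ?Q k" "tgt_to ?Q k m X \<in> cells ?Q k" using bd_to_cells[OF magma_glob[OF M], of m k X] km c by auto
    note ip = idn_to_props[OF M cs(1), of m] idn_to_props[OF M cs(2), of m]
    have 1: "idn_to ?Q k m (src_to ?Q k m X) = cls (teq A I) m (idn_to (raw A) k m (src_to (raw A) k m x)) \<and>
       teq A I m (idn_to (raw A) k m (src_to (raw A) k m x)) (idn_to (raw A) k m (src_to (raw A) k m x))"
      using T.Qidn_to[of k m A I "src_to (raw A) k m x"] km x s by (auto simp: T.Qsrc_to)
    have 2: "idn_to ?Q k m (tgt_to ?Q k m X) = cls (teq A I) m (idn_to (raw A) k m (tgt_to (raw A) k m x)) \<and>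
       teq A I m (idn_to (raw A) k m (tgt_to (raw A) k m x)) (idn_to (raw A) k m (tgt_to (raw A) k m x))"
      using T.Qidn_to[of k m A I "tgt_to (raw A) k m x"] km x s by (auto simp: T.Qtgt_to)
    have 3: "teq A I k (tgt_to (raw A) k m (idn_to (raw A) k m (src_to (raw A) k m x))) (src_to (raw A) k m x)"
      using 1 ip km x T.Qcomp[of k m A I "idn_to (raw A) k m (src_to (raw A) k m x)" x] by auto
    have 4: "teq A I k (tgt_to (raw A) k m x) (src_to (raw A) k m (idn_to (raw A) k m (tgt_to (raw A) k m x)))"
      using 2 ip km x T.Qcomp[of k m A I x "idn_to (raw A) k m (tgt_to (raw A) k m x)"] by auto
    have "cls (teq A I) m (Cmp m k x (idn_to (raw A) k m (src_to (raw A) k m x))) = cls (teq A I) m x"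
      using teq.unit_src[OF km x(1)] by (meson T.cls_eq T.l)
    then show "cmp ?Q m k X (idn_to ?Q k m (src_to ?Q k m X)) = X" using 1 3 km x by (simp add: T.Qcmp)
    have "cls (teq A I) m (Cmp m k (idn_to (raw A) k m (tgt_to (raw A) k m x)) x) = cls (teq A I) m x"
      using teq.unit_tgt[OF km x(1)] by (meson T.cls_eq T.l)
    then show "cmp ?Q m k (idn_to ?Q k m (tgt_to ?Q k m X)) X = X" using 2 4 km x by (simp add: T.Qcmp)
  }
  {
    fix m l k X Y Z W assume kl: "k < l" "l < m" "m \<le> 3" and c: "X \<in> cells ?Q m" "Y \<in> cells ?Q m" "Z \<in> cells ?Q m" "W \<in> cells ?Q m"
     and e: "tgt_to ?Q l m X = src_to ?Q l m Y" "tgt_to ?Q l m Z = src_to ?Q l m W" "tgt_to ?Q k m X = src_to ?Q k m Z"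
    obtain x y z w where x: "teq A I m x x" "X = cls (teq A I) m x" and y: "teq A I m y y" "Y = cls (teq A I) m y"
      and z: "teq A I m z z" "Z = cls (teq A I) m z" and w: "teq A I m w w" "W = cls (teq A I) m w" using c by (auto elim!: T.cellE)
    note ic = interchange_comp[OF M kl c e]
    have km: "k < m" using kl by simp
    have e': "teq A I l (tgt_to (raw A) l m x) (src_to (raw A) l m y)" "teq A I l (tgt_to (raw A) l m z) (src_to (raw A) l m w)"
       "teq A I k (tgt_to (raw A) k m x) (src_to (raw A) k m z)" "teq A I k (tgt_to (raw A) k m y) (src_to (raw A) k m w)"
      using e ic x y z w kl km by (auto simp: T.Qcomp)
    have ww: "teq A I m (Cmp m l y x) (Cmp m l y x)" "teq A I m (Cmp m l w z) (Cmp m l w z)"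
       "teq A I m (Cmp m k z x) (Cmp m k z x)" "teq A I m (Cmp m k w y) (Cmp m k w y)"
      using kl km x y z w e' by (auto intro: teq.cmp)
    have "teq A I k (tgt_to (raw A) k m (Cmp m l y x)) (src_to (raw A) k m (Cmp m l w z))"
      "teq A I l (tgt_to (raw A) l m (Cmp m k z x)) (src_to (raw A) l m (Cmp m k w y))"
      using ic(1,3) x y z w kl km e' ww by (auto simp: T.Qcmp T.Qcomp)
    then show "cmp ?Q m k (cmp ?Q m l W Z) (cmp ?Q m l Y X) = cmp ?Q m l (cmp ?Q m k W Y) (cmp ?Q m k Z X)"
      using x y z w kl km e' ww teq.interchange[OF kl x(1) y(1) z(1) w(1) e'(1-3)] by (simp add: T.Qcmp) (meson T.cls_eq T.l)
  }
  {
    fix m k X Y assume km: "k < m" "m < 3" and c: "X \<in> cells ?Q m" "Y \<in> cells ?Q m"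
     and e: "tgt_to ?Q k m X = src_to ?Q k m Y"
    obtain x y where x: "teq A I m x x" "X = cls (teq A I) m x" and y: "teq A I m y y" "Y = cls (teq A I) m y"
      using c by (auto elim!: T.cellE)
    have e': "teq A I k (tgt_to (raw A) k m x) (src_to (raw A) k m y)" using e x y km by (auto simp: T.Qcomp)
    have ww: "teq A I m (Cmp m k y x) (Cmp m k y x)" "teq A I (Suc m) (Idn m x) (Idn m x)" "teq A I (Suc m) (Idn m y) (Idn m y)"
      using km x y e' by (auto intro: teq.cmp teq.idn)
    show "cmp ?Q (Suc m) k (idn ?Q m Y) (idn ?Q m X) = idn ?Q m (cmp ?Q m k Y X)"
      using km x y e' ww teq.idn_cmp[OF km x(1) y(1) e'] by (simp add: T.Qcmp T.Qidn) (meson T.cls_eq T.l)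
  }
qed

theorem term_unit_map: "globular A \<Longrightarrow> glob_map A (term_magma A (teq A I)) (\<lambda>k a. cls (teq A I) k (Gen k a))"
  unfolding glob_map_def
  by (auto simp: T.Qsrc T.Qtgt teq.gen globD intro!: T.cellI)

lemma P_unit_map: "globular A \<Longrightarrow> glob_map A (term_magma A (peq A)) (N3_unit A)"
  unfolding glob_map_def N3_unit_def
  by (auto simp: P.Qsrc P.Qtgt peq.gen globD intro!: P.cellI)

lemma (in pcong) ev_map:
  assumes M: "is_magma M" and snd: "\<And>m x y. E m x y \<Longrightarrow> good A M c g m x \<and> good A M c g m y \<and> ev M c g x = ev M c g y"
  shows "magma_map Q M (\<lambda>k X. ev M c g (rep X))" "\<And>m x. E m x x \<Longrightarrow> ev M c g (rep (cls E m x)) = ev M c g x"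
proof -
  show *: "\<And>m x. E m x x \<Longrightarrow> ev M c g (rep (cls E m x)) = ev M c g x" using snd rep_cls by metis
  have g: "\<And>m x. E m x x \<Longrightarrow> good A M c g m x" using snd by blast
  show "magma_map Q M (\<lambda>k X. ev M c g (rep X))"
    unfolding magma_map_def glob_map_def
    using snd[THEN conjunct1, THEN good_cell] g
    by (fastforce elim!: cellE simp: Qsrc Qtgt Qidn Qcomp Qcmp * idn cmp src tgt)
qed

theorem free_ext:
  fixes B :: "'b magma"
  assumes A: "globular A" and B: "strict_3cat B" and g: "glob_map A B g"
    and I: "\<And>k a b. (k,a,b) \<in> I \<Longrightarrow> k < 3 \<Longrightarrow> a \<in> cells A k \<Longrightarrow> b \<in> cells A (Suc k) \<Longrightarrow> g (Suc k) b = idn B k (g k a)"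
  shows "magma_map (term_magma A (teq A I)) B (\<lambda>k X. ev B c g (rep X))" (is ?a)
   and "k \<le> 3 \<Longrightarrow> a \<in> cells A k \<Longrightarrow> ev B c g (rep (cls (teq A I) k (Gen k a))) = g k a" (is "_ \<Longrightarrow> _ \<Longrightarrow> ?b")
proof -
  have s: "\<And>m x y. teq A I m x y \<Longrightarrow> good A B c g m x \<and> good A B c g m y \<and> ev B c g x = ev B c g y"
    using teq_sound[OF A B g, of I] I by blast
  show ?a using T.ev_map(1)[OF strict_magma[OF B]] s by metis
  assume "k \<le> 3" "a \<in> cells A k"
  then show ?b using T.ev_map(2)[OF strict_magma[OF B] s teq.gen] by simp
qed

lemma (in pcong) map_rules:
  assumes h: "magma_map Q M h"
  shows "E (Suc m) x x \<Longrightarrow> h m (cls E m (tsrc A x)) = src M (Suc m) (h (Suc m) (cls E (Suc m) x))"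
   "E (Suc m) x x \<Longrightarrow> h m (cls E m (ttgt A x)) = tgt M (Suc m) (h (Suc m) (cls E (Suc m) x))"
   "k < 3 \<Longrightarrow> E k x x \<Longrightarrow> h (Suc k) (cls E (Suc k) (Idn k x)) = idn M k (h k (cls E k x))"
   "k < m \<Longrightarrow> m \<le> 3 \<Longrightarrow> E m x x \<Longrightarrow> E m y y \<Longrightarrow> E k (tgt_to (raw A) k m x) (src_to (raw A) k m y) \<Longrightarrow>
     h m (cls E m (Cmp m k y x)) = cmp M m k (h m (cls E m y)) (h m (cls E m x))"
   "E m x x \<Longrightarrow> h m (cls E m x) \<in> cells M m"
proof -
  show "h m (cls E m (tsrc A x)) = src M (Suc m) (h (Suc m) (cls E (Suc m) x))" if "E (Suc m) x x"
    using h cellI[OF that] le3[OF that] unfolding magma_map_def glob_map_def by (metis Qsrc[OF that] Suc_le_eq)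
  show "h m (cls E m (ttgt A x)) = tgt M (Suc m) (h (Suc m) (cls E (Suc m) x))" if "E (Suc m) x x"
    using h cellI[OF that] le3[OF that] unfolding magma_map_def glob_map_def by (metis Qtgt[OF that] Suc_le_eq)
  show "h (Suc k) (cls E (Suc k) (Idn k x)) = idn M k (h k (cls E k x))" if "k < 3" "E k x x"
    using h cellI[OF that(2)] that unfolding magma_map_def by (metis Qidn[OF that])
  show "h m (cls E m (Cmp m k y x)) = cmp M m k (h m (cls E m y)) (h m (cls E m x))"
    if "k < m" "m \<le> 3" "E m x x" "E m y y" "E k (tgt_to (raw A) k m x) (src_to (raw A) k m y)"
    using h cellI[OF that(3)] cellI[OF that(4)] that Qcomp[of k m x y] unfolding magma_map_def
    by (metis Qcmp[OF that] less_imp_le)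
  show "h m (cls E m x) \<in> cells M m" if "E m x x"
    using h cellI[OF that] le3[OF that] unfolding magma_map_def glob_map_def by blast
qed

lemma (in pcong) map_to: 
  assumes h: "magma_map Q M h"
  shows "k \<le> m \<Longrightarrow> E m x x \<Longrightarrow> h k (cls E k (src_to (raw A) k m x)) = src_to M k m (h m (cls E m x)) \<and>
    h k (cls E k (tgt_to (raw A) k m x)) = tgt_to M k m (h m (cls E m x))"
proof (induction m arbitrary: x)
  case (Suc m)
  show ?case
  proof (cases "k = Suc m")
    case False
    then show ?thesis using Suc map_rules(1,2)[OF h Suc.prems(2)] src[OF Suc.prems(2)] tgt[OF Suc.prems(2)] by auto
  qed auto
qed auto

theorem free_unique:
  assumes A: "globular A" and B: "strict_3cat B" and h: "magma_map (term_magma A (teq A I)) B h" and h': "magma_map (term_magma A (teq A I)) B h'"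
   and e: "\<And>k a. k \<le> 3 \<Longrightarrow> a \<in> cells A k \<Longrightarrow> h k (cls (teq A I) k (Gen k a)) = h' k (cls (teq A I) k (Gen k a))"
  and X: "X \<in> cells (term_magma A (teq A I)) k"
  shows "h k X = h' k X"
proof -
  let ?c = "cls (teq A I)"
  have cong: "\<And>m x y. teq A I m x y \<Longrightarrow> ?c m x = ?c m y" using T.cls_eq T.l by metis
  note r = T.map_rules[OF h] and r' = T.map_rules[OF h']
  let ?e = "\<lambda>m x. teq A I m x x \<and> h m (?c m x) = h' m (?c m x)"
  have e_cong: "?e m y" if "teq A I m x y" "?e m x" for m x y
    using that cong[OF that(1)] T.r[OF that(1)] by simp
  have e_src: "?e m (tsrc A x)" if "?e (Suc m) x" for m x
    using that r(1)[of m x] r'(1)[of m x] by (auto intro: teq.src)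
  have e_tgt: "?e m (ttgt A x)" if "?e (Suc m) x" for m x
    using that r(2)[of m x] r'(2)[of m x] by (auto intro: teq.tgt)
  have e_idn: "?e (Suc k) (Idn k x)" if "k < 3" "?e k x" for k x
    using that r(3)[of k x] r'(3)[of k x] by (auto intro: teq.idn)
  have e_cmp: "?e m (Cmp m k y x)" if "k < m" "m \<le> 3" "?e m x" "?e m y"
    "teq A I k (tgt_to (raw A) k m x) (src_to (raw A) k m y)" for m k x y
    using that r(4)[of k m x y] r'(4)[of k m x y] by (auto intro: teq.cmp)
  have "teq A I m x y \<Longrightarrow> ?e m x \<and> ?e m y" for m x y
  proof (induction rule: teq.induct)
    case (gen k a) then show ?case using e by (auto intro: teq.gen)
  next
    case (gen_idn k a b)
    then have "?e (Suc k) (Gen (Suc k) b)" using e by (auto intro: teq.gen)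
    then show ?case using e_cong teq.gen_idn[OF gen_idn] by blast
  next
    case (src m x y) then show ?case using e_src by blast
  next
    case (tgt m x y) then show ?case using e_tgt by blast
  next
    case (idn k x y) then show ?case using e_idn by blast
  next
    case (cmp k m x x' y y')
    then show ?case using e_cmp[of k m x y] e_cong[OF teq.cmp[OF cmp.hyps]] by blast
  next
    case (glob_src m x) then show ?case using e_src e_tgt by blast
  next
    case (glob_tgt m x) then show ?case using e_src e_tgt by blast
  next
    case (assoc k m x y z)
    have "?e m (Cmp m k y x)" using assoc by (intro e_cmp) auto
    moreover have "teq A I k (tgt_to (raw A) k m (Cmp m k y x)) (src_to (raw A) k m z)"
    proof -
      let ?Q = "term_magma A (teq A I)"
      have "tgt_to ?Q k m (cmp ?Q m k (?c m y) (?c m x)) = src_to ?Q k m (?c m z)"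
      proof -
        have c: "?c m x \<in> cells ?Q m" "?c m y \<in> cells ?Q m" using assoc by (auto intro: T.cellI)
        have e1: "tgt_to ?Q k m (?c m x) = src_to ?Q k m (?c m y)" "tgt_to ?Q k m (?c m y) = src_to ?Q k m (?c m z)"
          using assoc by (auto simp: T.Qcomp)
        show ?thesis using cmp_to[OF T.Qmagma assoc(1,2) c e1(1), of k] e1 assoc(1) by simp
      qed
      then show ?thesis using assoc teq.cmp[of k m A I x x y y] by (simp add: T.Qcmp T.Qcomp)
    qed
    ultimately have "?e m (Cmp m k z (Cmp m k y x))" using assoc by (intro e_cmp) auto
    then show ?case using e_cong teq.sym[OF teq.assoc[OF assoc.hyps]] by blast
  next
    case (unit_src k m x) then show ?case using e_cong[OF teq.sym[OF teq.unit_src]] by blast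
  next
    case (unit_tgt k m x) then show ?case using e_cong[OF teq.sym[OF teq.unit_tgt]] by blast
  next
    case (interchange k l m x y z w)
    let ?Q = "term_magma A (teq A I)"
    have km: "k < m" using interchange by simp
    have w1: "?e m (Cmp m l y x)" by (rule e_cmp) (use interchange in blast)+
    have w2: "?e m (Cmp m l w z)" by (rule e_cmp) (use interchange in blast)+
    note w = w1 w2
    have "tgt_to ?Q k m (cmp ?Q m l (?c m y) (?c m x)) = src_to ?Q k m (cmp ?Q m l (?c m w) (?c m z))"
      using interchange km by (intro interchange_comp(1)[OF T.Qmagma]) (auto simp: T.Qcomp intro: T.cellI)
    then have "teq A I k (tgt_to (raw A) k m (Cmp m l y x)) (src_to (raw A) k m (Cmp m l w z))"
      using interchange w km by (simp add: T.Qcmp T.Qcomp)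
    then have "?e m (Cmp m k (Cmp m l w z) (Cmp m l y x))" by - (rule e_cmp, use w km interchange(3) in auto)
    then show ?case using e_cong teq.interchange[OF interchange.hyps] by blast
  next
    case (idn_cmp k m x y)
    then have "?e (Suc m) (Idn m (Cmp m k y x))" by (intro e_idn e_cmp) auto
    then show ?case using e_cong teq.sym[OF teq.idn_cmp[OF idn_cmp.hyps]] by blast
  qed simp_all
  then show ?thesis using X by (auto elim!: T.cellE)
qed

lemma proj_simps:
  "proj A (Gen k a) = free_cat_unit A k a"
  "proj A (Idn k x) = idn (free_cat A) k (proj A x)"
  "proj A (Cmp m k y x) = cmp (free_cat A) m k (proj A y) (proj A x)"
  "proj A (Con k x y) = idn (free_cat A) k (proj A x)"
  by (simp_all add: proj_def)

lemma free_strict: "strict_3cat (free_cat A)" unfolding free_cat_def by (rule term_strict)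
lemma free_unit_map: "globular A \<Longrightarrow> glob_map A (free_cat A) (free_cat_unit A)"
  using term_unit_map[of A "{}"] unfolding free_cat_def free_cat_unit_def by simp

abbreviation "idc A \<equiv> (\<lambda>k X (Y::'a trm set). idn (free_cat (A::'a glob)) k X)"

lemma peq_proj:
  assumes A: "globular A"
  shows "peq A m x y \<Longrightarrow> good A (free_cat A) (idc A) (free_cat_unit A) m x \<and>
     good A (free_cat A) (idc A) (free_cat_unit A) m y \<and> proj A x = proj A y"
  unfolding proj_def
proof (induction rule: peq.induct)
  note M = strict_magma[OF free_strict[of A]]
  note G = magma_glob[OF M]
  let ?T = "free_cat A"
  {
    case gen then show ?case using good_gen[OF A free_unit_map[OF A]] by auto
  next
    case sym then show ?case by simp
  next
    case trans then show ?case by simp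
  next
    case src then show ?case by simp
  next
    case tgt then show ?case by simp
  next
    case idn then show ?case using good_idn[OF M] by (auto simp del: good.simps)
  next
    case (cmp k m x x' y y')
    then have gd: "good A ?T (idc A) (free_cat_unit A) m x" "good A ?T (idc A) (free_cat_unit A) m y" by auto
    have "tgt_to ?T k m (ev ?T (idc A) (free_cat_unit A) x) = src_to ?T k m (ev ?T (idc A) (free_cat_unit A) y)"
      using cmp good_to[OF gd(1), of k] good_to[OF gd(2), of k] by auto
    then have "good A ?T (idc A) (free_cat_unit A) m (Cmp m k y x)" "good A ?T (idc A) (free_cat_unit A) m (Cmp m k y' x')"
      using cmp by (auto intro!: good_cmp[OF M])
    then show ?case using cmp by auto
  next
    case (glob_src m x)
    then show ?case using globD2[OF G, of m "ev ?T (idc A) (free_cat_unit A) x"] peq_le3[OF glob_src(1)] by auto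
  next
    case (glob_tgt m x)
    then show ?case using globD2[OF G, of m "ev ?T (idc A) (free_cat_unit A) x"] peq_le3[OF glob_tgt(1)] by auto
  next
    case (con k x x' y y')
    let ?v = "ev ?T (idc A) (free_cat_unit A)" and ?g = "good A ?T (idc A) (free_cat_unit A)"
    have e: "?v x = ?v y" using con.hyps(4) unfolding proj_def .
    have gd: "?g k x" "?g k y" "?g k x'" "?g k y'" and e2: "?v x' = ?v x" "?v y' = ?v y"
      using con.IH(1,2) by blast+
    note d = idnD[OF M con(1) good_cell[OF gd(1)]]
    have 1: "?g (Suc k) (Con k x y)"
      by (rule good_con[OF M con(1) gd(1,2)]) (simp_all only: d e[symmetric])
    have 2: "?g (Suc k) (Con k x' y')"
      by (rule good_con[OF M con(1) gd(3,4)]) (simp_all only: e2 d e[symmetric])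
    show ?case using 1 2 e2 by (simp del: good.simps)
  next
    case (con_same k x)
    let ?g = "good A ?T (idc A) (free_cat_unit A)"
    have gd: "?g k x" using con_same.IH by blast
    note d = idnD[OF M con_same(1) good_cell[OF gd]]
    have "?g (Suc k) (Con k x x)"
      by (rule good_con[OF M con_same(1) gd gd]) (simp_all only: d)
    then show ?case using good_idn[OF M con_same(1) gd] by (simp del: good.simps)
  next
    case collapse then show ?case by (simp add: proj_def)
  }
qed

lemma parallel_cls: assumes "peq A k x x" "peq A k y y"
  shows "parallel (term_magma A (peq A)) k (cls (peq A) k x) (cls (peq A) k y) \<longleftrightarrow>
     k = 0 \<or> (peq A (k - 1) (tsrc A x) (tsrc A y) \<and> peq A (k - 1) (ttgt A x) (ttgt A y))"
proof (cases k)
  case 0 then show ?thesis using assms by (auto simp: parallel_def intro: P.cellI)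
next
  case (Suc n)
  have "peq A n (tsrc A x) (tsrc A x)" "peq A n (ttgt A x) (ttgt A x)" using assms Suc by (auto intro: peq.src peq.tgt)
  then show ?thesis using assms Suc by (auto simp: parallel_def P.Qsrc P.Qtgt P.cls_eq intro: P.cellI)
qed

lemma proj_rep: assumes "globular A" "peq A m x x" shows "proj A (rep (cls (peq A) m x)) = proj A x"
  using peq_proj[OF assms(1) P.rep_cls[OF assms(2)]] by simp

lemma Pcons: assumes "globular A" "k < 3" "peq A k x x" "peq A k y y"
   "k = 0 \<or> (peq A (k - 1) (tsrc A x) (tsrc A y) \<and> peq A (k - 1) (ttgt A x) (ttgt A y))" "proj A x = proj A y"
  shows "qc (freeQ A) k (cls (peq A) k x) (cls (peq A) k y) = cls (peq A) (Suc k) (Con k x y)"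
proof -
  have 1: "peq A (Suc k) (Con k x y) (Con k (rep (cls (peq A) k x)) (rep (cls (peq A) k y)))"
    by (rule peq.con[OF assms(2) P.rep_cls[OF assms(3)] P.rep_cls[OF assms(4)] assms(5,6)])
  then show ?thesis unfolding freeQ_def using P.cls_eq[OF P.l[OF 1], THEN iffD2, OF 1] by simp
qed

theorem freeQ_object: assumes A: "globular A" shows "Q_object (freeQ A)"
proof -
  let ?X = "term_magma A (peq A)" and ?c = "cls (peq A)"
  note M = P.Qmagma[of A]
  have 1: "magma_map ?X (free_cat A) (\<lambda>k X. proj A (rep X))"
    using P.ev_map(1)[OF strict_magma[OF free_strict[of A]], of A "idc A" "free_cat_unit A"] peq_proj[OF A]
    unfolding proj_def by blast
  have 2: "contraction ?X (free_cat A) (\<lambda>k X. proj A (rep X)) (qc (freeQ A))"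
    unfolding contraction_def
  proof (intro conjI allI impI ballI; (elim conjE)?)
    fix k X Y assume k: "(k::nat) < 3" and p: "parallel ?X k X Y" and e: "proj A (rep X) = proj A (rep Y)"
    from p have c: "X \<in> cells ?X k" "Y \<in> cells ?X k" by (auto simp: parallel_def)
    obtain x y where x: "peq A k x x" "X = ?c k x" and y: "peq A k y y" "Y = ?c k y"
      using c by (auto elim!: P.cellE)
    have p': "k = 0 \<or> (peq A (k - 1) (tsrc A x) (tsrc A y) \<and> peq A (k - 1) (ttgt A x) (ttgt A y))"
      using p x y parallel_cls by metis
    have e': "proj A x = proj A y" using e x y proj_rep[OF A] by simp
    note q = Pcons[OF A k x(1) y(1) p' e']
    have w: "peq A (Suc k) (Con k x y) (Con k x y)" using k x y p' e' by (intro peq.con) auto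
    show "qc (freeQ A) k X Y \<in> cells ?X (Suc k)" using q x y w by (auto intro: P.cellI)
    show "src ?X (Suc k) (qc (freeQ A) k X Y) = X" "tgt ?X (Suc k) (qc (freeQ A) k X Y) = Y"
      using q x y w by (simp_all add: P.Qsrc P.Qtgt)
    show "proj A (rep (qc (freeQ A) k X Y)) = idn (free_cat A) k (proj A (rep X))"
      using q x y w proj_rep[OF A] by (simp add: proj_simps)
  next
    fix k X assume k: "(k::nat) < 3" and c: "X \<in> cells ?X k"
    obtain x where x: "peq A k x x" "X = ?c k x" using c by (auto elim!: P.cellE)
    have p': "k = 0 \<or> (peq A (k - 1) (tsrc A x) (tsrc A x) \<and> peq A (k - 1) (ttgt A x) (ttgt A x))"
      using x(1) by (cases k) (auto intro: peq.src peq.tgt)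
    have "?c (Suc k) (Con k x x) = ?c (Suc k) (Idn k x)"
      using P.cls_eq peq.con_same[OF k x(1)] P.l by metis
    then show "qc (freeQ A) k X X = idn ?X k X"
      using Pcons[OF A k x(1) x(1) p' refl] x k by (simp add: P.Qidn)
  next
    fix X Y assume p: "parallel ?X 3 X Y" and e: "proj A (rep X) = proj A (rep Y)"
    from p have c: "X \<in> cells ?X 3" "Y \<in> cells ?X 3" by (auto simp: parallel_def)
    obtain x y where x: "peq A 3 x x" "X = ?c 3 x" and y: "peq A 3 y y" "Y = ?c 3 y"
      using c by (auto elim!: P.cellE)
    have "3 - 1 = (2::nat)" by simp
    then have "peq A 2 (tsrc A x) (tsrc A y) \<and> peq A 2 (ttgt A x) (ttgt A y)"
      using p x y parallel_cls[OF x(1) y(1)] by simp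
    moreover have "proj A x = proj A y" using e x y proj_rep[OF A] by simp
    ultimately show "X = Y" using x y peq.collapse P.cls_eq by metis
  qed
  show ?thesis unfolding Q_object_def using M 1 2 free_strict[of A] by (simp add: freeQ_def)
qed

lemma parallel_good:
  assumes "good A M c g k x" "good A M c g k y"
    "k = 0 \<or> (ev M c g (tsrc A x) = ev M c g (tsrc A y) \<and> ev M c g (ttgt A x) = ev M c g (ttgt A y))"
  shows "parallel M k (ev M c g x) (ev M c g y)"
  using assms by (cases k) (auto simp: parallel_def)

lemma peq_sound:
  fixes Q :: "('x, 'b) qobj"
  assumes A: "globular A" and Q: "Q_object Q" and g: "glob_map A (qX Q) g"
    and E: "magma_map (free_cat A) (qB Q) E"
    and Eg: "\<And>k a. k \<le> 3 \<Longrightarrow> a \<in> cells A k \<Longrightarrow> E k (free_cat_unit A k a) = qf Q k (g k a)"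
  defines "v \<equiv> ev (qX Q) (qc Q) g"
  shows "peq A m x y \<Longrightarrow> good A (qX Q) (qc Q) g m x \<and> good A (qX Q) (qc Q) g m y \<and> v x = v y \<and>
     qf Q m (v x) = E m (proj A x) \<and> qf Q m (v y) = E m (proj A y)"
  unfolding v_def
proof (induction rule: peq.induct)
  let ?X = "qX Q" let ?B = "qB Q" let ?f = "qf Q" let ?c = "qc Q" let ?v = "ev (qX Q) (qc Q) g"
  let ?T = "free_cat A"
  let ?good = "good A ?X ?c g" and ?goodT = "good A ?T (idc A) (free_cat_unit A)"
  have M: "is_magma ?X" and f: "magma_map ?X ?B ?f" and C: "contraction ?X ?B ?f ?c" using Q by (auto simp: Q_object_def)
  note G = magma_glob[OF M] note pp = peq_proj[OF A]
  note P = proj_def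
  note evT = proj_def[symmetric, THEN fun_cong]
  have gT: "?goodT m x" "?goodT m y" if "peq A m x y" for m x y using pp[OF that] by auto
  have fs: "?f m (src ?X (Suc m) z) = src ?B (Suc m) (?f (Suc m) z)" "?f m (tgt ?X (Suc m) z) = tgt ?B (Suc m) (?f (Suc m) z)"
    if "z \<in> cells ?X (Suc m)" "m < 3" for m z using f that by (auto simp: magma_map_def glob_map_def)
  have Es: "E m (src ?T (Suc m) z) = src ?B (Suc m) (E (Suc m) z)" "E m (tgt ?T (Suc m) z) = tgt ?B (Suc m) (E (Suc m) z)"
    if "z \<in> cells ?T (Suc m)" "m < 3" for m z using E that by (auto simp: magma_map_def glob_map_def)
  have fi: "?f (Suc k) (idn ?X k z) = idn ?B k (?f k z)" if "z \<in> cells ?X k" "k < 3" for k z using f that by (auto simp: magma_map_def)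
  have Ei: "E (Suc k) (idn ?T k z) = idn ?B k (E k z)" if "z \<in> cells ?T k" "k < 3" for k z using E that by (auto simp: magma_map_def)
  have bs: "?f m (?v (tsrc A x)) = E m (proj A (tsrc A x))" "?f m (?v (ttgt A x)) = E m (proj A (ttgt A x))"
    if "peq A (Suc m) x x" "?good (Suc m) x" "?f (Suc m) (?v x) = E (Suc m) (proj A x)" for m x
  proof -
    have t: "?goodT (Suc m) x" using gT that by blast
    have m: "m < 3" using peq_le3[OF that(1)] by simp
    have t1: "proj A (tsrc A x) = src ?T (Suc m) (proj A x)" "proj A (ttgt A x) = tgt ?T (Suc m) (proj A x)"
      "proj A x \<in> cells ?T (Suc m)"
      using t by (auto simp: proj_def)
    have v1: "?v (tsrc A x) = src ?X (Suc m) (?v x)" "?v (ttgt A x) = tgt ?X (Suc m) (?v x)" "?v x \<in> cells ?X (Suc m)"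
      using that by auto
    show "?f m (?v (tsrc A x)) = E m (proj A (tsrc A x))" "?f m (?v (ttgt A x)) = E m (proj A (ttgt A x))"
      using fs[OF v1(3) m] Es[OF t1(3) m] t1 v1 that(3) by simp_all
  qed
  {
    case (gen k a) then show ?case using good_gen[OF A g] Eg by (auto simp: proj_simps)
  next
    case sym then show ?case by metis
  next
    case trans then show ?case by metis
  next
    case (src m x y)
    have "peq A (Suc m) x x" "peq A (Suc m) y y" using src(1) P.l P.r by blast+
    then show ?case using src bs[of m x] bs[of m y] by auto
  next
    case (tgt m x y)
    have "peq A (Suc m) x x" "peq A (Suc m) y y" using tgt(1) P.l P.r by blast+
    then show ?case using tgt bs[of m x] bs[of m y] by auto
  next
    case (idn k x y)
    have gd: "?good k x" "?good k y" and ve: "?v y = ?v x" and fe: "?f k (?v x) = E k (proj A x)" by (use idn.IH in metis)+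
    note c = good_cell[OF gd(1)]
    have t: "proj A x \<in> cells ?T k" using gT[OF idn(2)] good_cell unfolding proj_def by blast
    have e: "proj A y = proj A x" using pp[OF idn(2)] by simp
    have gg: "?good (Suc k) (Idn k x)" "?good (Suc k) (Idn k y)" by (rule good_idn[OF M idn(1)], rule gd)+
    show ?case using gg
      by (simp only: ev.simps ve proj_simps e fi[OF c idn(1)] Ei[OF t idn(1)] fe simp_thms)
  next
    case (cmp k m x x' y y')
    have gd: "?good m x" "?good m y" "?good m x'" "?good m y'" and ve: "?v x' = ?v x" "?v y' = ?v y"
      and fe: "?f m (?v x) = E m (proj A x)" "?f m (?v y) = E m (proj A y)"
      by (use cmp.IH(1,2) in metis)+
    note cc = gd(1,2)[THEN good_cell]
    have "?v (tgt_to (raw A) k m x) = ?v (src_to (raw A) k m y)" using cmp.IH(3) by blast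
    then have co: "tgt_to ?X k m (?v x) = src_to ?X k m (?v y)"
      using good_to[OF gd(1), of k] good_to[OF gd(2), of k] less_imp_le[OF cmp(1)] by metis
    have gd1: "?good m (Cmp m k y x)" by (rule good_cmp[OF M cmp(1,2) gd(1,2) co])
    have gd2: "?good m (Cmp m k y' x')" by (rule good_cmp[OF M cmp(1,2) gd(3,4)]) (simp only: ve co)
    have gt: "?goodT m x" "?goodT m y" using gT cmp(3,4) by blast+
    have tc: "proj A x \<in> cells ?T m" "proj A y \<in> cells ?T m" using gt good_cell unfolding proj_def by blast+
    have "proj A (tgt_to (raw A) k m x) = proj A (src_to (raw A) k m y)" using pp[OF cmp(5)] by blast
    then have tco: "tgt_to ?T k m (proj A x) = src_to ?T k m (proj A y)"
      using good_to[OF gt(1), of k] good_to[OF gt(2), of k] less_imp_le[OF cmp(1)] unfolding proj_def by metis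
    have 1: "?f m (cmp ?X m k (?v y) (?v x)) = cmp ?B m k (?f m (?v y)) (?f m (?v x))"
      using f cc co cmp(1,2) unfolding magma_map_def by blast
    have 2: "E m (cmp ?T m k (proj A y) (proj A x)) = cmp ?B m k (E m (proj A y)) (E m (proj A x))"
      using E tc tco cmp(1,2) unfolding magma_map_def by blast
    have 3: "proj A x' = proj A x" "proj A y' = proj A y" using pp[OF cmp(3)] pp[OF cmp(4)] by simp_all
    show ?case using gd1 gd2 by (simp only: ev.simps proj_simps ve 1 2 3 fe simp_thms)
  next
    case (glob_src m x)
    note s = peq.src[OF glob_src(1)] peq.tgt[OF glob_src(1)]
    have g1: "?good (Suc m) (tsrc A x)" "?good (Suc m) (ttgt A x)" using glob_src by auto
    have b: "?f (Suc m) (?v (tsrc A x)) = E (Suc m) (proj A (tsrc A x))" "?f (Suc m) (?v (ttgt A x)) = E (Suc m) (proj A (ttgt A x))"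
      using glob_src bs[of "Suc m" x] by auto
    show ?case using globD2[OF G, of m "?v x"] peq_le3[OF glob_src(1)] glob_src.IH
      bs[OF s(1) g1(1) b(1)] bs[OF s(2) g1(2) b(2)] by auto
  next
    case (glob_tgt m x)
    note s = peq.src[OF glob_tgt(1)] peq.tgt[OF glob_tgt(1)]
    have g1: "?good (Suc m) (tsrc A x)" "?good (Suc m) (ttgt A x)" using glob_tgt by auto
    have b: "?f (Suc m) (?v (tsrc A x)) = E (Suc m) (proj A (tsrc A x))" "?f (Suc m) (?v (ttgt A x)) = E (Suc m) (proj A (ttgt A x))"
      using glob_tgt bs[of "Suc m" x] by auto
    show ?case using globD2[OF G, of m "?v x"] peq_le3[OF glob_tgt(1)] glob_tgt.IH
      bs[OF s(1) g1(1) b(1)] bs[OF s(2) g1(2) b(2)] by auto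
  next
    case (con k x x' y y')
    have gd: "?good k x" "?good k y" "?good k x'" "?good k y'" and ve: "?v x' = ?v x" "?v y' = ?v y"
      and fx: "?f k (?v x) = E k (proj A x)" and fy: "?f k (?v y) = E k (proj A y)" by (use con.IH(1,2) in metis)+
    have p: "parallel ?X k (?v x) (?v y)"
      by (rule parallel_good[OF gd(1,2)]) (use con.IH(3) in blast)
    have pe: "proj A y = proj A x" using con.hyps(4) by simp
    have fe: "?f k (?v x) = ?f k (?v y)" by (simp only: fx fy pe)
    have c: "?c k (?v x) (?v y) \<in> cells ?X (Suc k)" "src ?X (Suc k) (?c k (?v x) (?v y)) = ?v x"
      "tgt ?X (Suc k) (?c k (?v x) (?v y)) = ?v y" "?f (Suc k) (?c k (?v x) (?v y)) = idn ?B k (?f k (?v x))"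
      using C p fe con(1) unfolding contraction_def by blast+
    have g1: "?good (Suc k) (Con k x y)" by (rule good_con[OF M con(1) gd(1,2) c(1-3)])
    have g2: "?good (Suc k) (Con k x' y')" by (rule good_con[OF M con(1) gd(3,4)]) (simp_all only: ve c)
    have t: "proj A x \<in> cells ?T k" using gT[OF con(2)] good_cell unfolding proj_def by blast
    have e: "proj A x' = proj A x" using pp[OF con(2)] by simp
    show ?case using g1 g2 by (simp only: ev.simps proj_simps ve e c(4) Ei[OF t con(1)] fx simp_thms)
  next
    case (con_same k x)
    have gd: "?good k x" and fx: "?f k (?v x) = E k (proj A x)" by (use con_same.IH in metis)+
    note cx = good_cell[OF gd]
    have c: "?c k (?v x) (?v x) = idn ?X k (?v x)"
      using C cx con_same(1) unfolding contraction_def by blast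
    have t: "proj A x \<in> cells ?T k" using gT[OF con_same(2)] good_cell unfolding proj_def by blast
    have g1: "?good (Suc k) (Con k x x)"
      by (rule good_con[OF M con_same(1) gd gd]) (simp_all only: c idnD[OF M con_same(1) cx])
    have g2: "?good (Suc k) (Idn k x)" by (rule good_idn[OF M con_same(1) gd])
    show ?case using g1 g2
      by (simp only: ev.simps proj_simps c fi[OF cx con_same(1)] Ei[OF t con_same(1)] fx simp_thms)
  next
    case (collapse x y)
    have gd: "?good 3 x" "?good 3 y" and fx: "?f 3 (?v x) = E 3 (proj A x)" "?f 3 (?v y) = E 3 (proj A y)"
      by (use collapse.IH(1,2) in metis)+
    have pe: "proj A y = proj A x" using collapse by simp
    have p: "parallel ?X 3 (?v x) (?v y)" by (rule parallel_good[OF gd]) (use collapse.IH(3,4) in simp)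
    have "?f 3 (?v x) = ?f 3 (?v y)" by (simp only: fx pe)
    then have "?v x = ?v y" using C p unfolding contraction_def by blast
    then show ?case using gd fx by blast
  }
qed

definition free_ext_map :: "'b magma \<Rightarrow> (nat \<Rightarrow> 'a \<Rightarrow> 'b) \<Rightarrow> nat \<Rightarrow> 'a trm set \<Rightarrow> 'b" where
  "free_ext_map B g k X = ev B (\<lambda>_ x _. x) g (rep X)"

theorem N3_universal:
  fixes Q :: "('x, 'b) qobj"
  assumes A: "globular A" and Q: "Q_object Q" and g: "glob_map A (qX Q) g"
  defines "E \<equiv> free_ext_map (qB Q) (\<lambda>k a. qf Q k (g k a))"
  shows "Q_morphism (freeQ A) Q (N3_ext Q g) E"
    and "\<And>k a. k \<le> 3 \<Longrightarrow> a \<in> cells A k \<Longrightarrow> N3_ext Q g k (N3_unit A k a) = g k a"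
    and "\<And>h e k X. Q_morphism (freeQ A) Q h e \<Longrightarrow>
       (\<And>k a. k \<le> 3 \<Longrightarrow> a \<in> cells A k \<Longrightarrow> h k (N3_unit A k a) = g k a) \<Longrightarrow>
       (X \<in> cells (qX (freeQ A)) k \<longrightarrow> h k X = N3_ext Q g k X)"
    and "\<And>h e k X. Q_morphism (freeQ A) Q h e \<Longrightarrow>
       (\<And>k a. k \<le> 3 \<Longrightarrow> a \<in> cells A k \<Longrightarrow> h k (N3_unit A k a) = g k a) \<Longrightarrow>
       (X \<in> cells (qB (freeQ A)) k \<longrightarrow> e k X = E k X)"
proof -
  let ?X = "term_magma A (peq A)"
  have B: "strict_3cat (qB Q)" and M: "is_magma (qX Q)" and f: "magma_map (qX Q) (qB Q) (qf Q)" using Q by (auto simp: Q_object_def)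
  have fg: "glob_map A (qB Q) (\<lambda>k a. qf Q k (g k a))"
    unfolding glob_map_def
  proof (intro conjI allI impI ballI)
    have fm: "glob_map (qX Q) (qB Q) (qf Q)" using f by (simp add: magma_map_def)
    note f1 = fm[unfolded glob_map_def, THEN conjunct1, rule_format] and f2 = fm[unfolded glob_map_def, THEN conjunct2, rule_format]
    note g1 = g[unfolded glob_map_def, THEN conjunct1, rule_format] and g2 = g[unfolded glob_map_def, THEN conjunct2, rule_format]
    show "qf Q k (g k a) \<in> cells (qB Q) k" if "k \<le> 3" "a \<in> cells A k" for k a using f1 g1 that by blast
    fix k a assume k: "(k::nat) < 3" and a: "a \<in> cells A (Suc k)"
    have "g (Suc k) a \<in> cells (qX Q) (Suc k)" using g1 k a by simp
    then show "qf Q k (g k (src A (Suc k) a)) = src (qB Q) (Suc k) (qf Q (Suc k) (g (Suc k) a))"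
      "qf Q k (g k (tgt A (Suc k) a)) = tgt (qB Q) (Suc k) (qf Q (Suc k) (g (Suc k) a))"
      using f2[OF k] g2[OF k a] by simp_all
  qed
  have E1: "magma_map (free_cat A) (qB Q) E"
    unfolding E_def free_ext_map_def[abs_def] free_cat_def by (rule free_ext(1)[OF A B fg]) simp
  have E2: "\<And>k a. k \<le> 3 \<Longrightarrow> a \<in> cells A k \<Longrightarrow> E k (free_cat_unit A k a) = qf Q k (g k a)"
    unfolding E_def free_ext_map_def[abs_def] free_cat_unit_def by (rule free_ext(2)[OF A B fg]) simp
  note E = E1 E2
  have s: "good A (qX Q) (qc Q) g m x \<and> good A (qX Q) (qc Q) g m y \<and> ev (qX Q) (qc Q) g x = ev (qX Q) (qc Q) g y \<and>
     qf Q m (ev (qX Q) (qc Q) g x) = E m (proj A x) \<and> qf Q m (ev (qX Q) (qc Q) g y) = E m (proj A y)" if "peq A m x y" for m x y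
    by (rule peq_sound[OF A Q g E1 _ that]) (rule E2)
  have s': "peq A m x y \<Longrightarrow> good A (qX Q) (qc Q) g m x \<and> good A (qX Q) (qc Q) g m y \<and> ev (qX Q) (qc Q) g x = ev (qX Q) (qc Q) g y" for m x y
    using s[of m x y] by metis
  have ext: "N3_ext Q g m (cls (peq A) m x) = ev (qX Q) (qc Q) g x" if "peq A m x x" for m x
    unfolding N3_ext_def by (rule P.ev_map(2)[OF M s' that])
  have h: "magma_map ?X (qX Q) (N3_ext Q g)" unfolding N3_ext_def[abs_def] by (rule P.ev_map(1)[OF M s'])
  show un: "N3_ext Q g k (N3_unit A k a) = g k a" if "k \<le> 3" "a \<in> cells A k" for k a
    unfolding N3_unit_def using ext[OF peq.gen[OF that]] by simp
  have sq: "qf Q k (N3_ext Q g k X) = E k (proj A (rep X))" if cX: "X \<in> cells ?X k" for k X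
  proof -
    obtain x where x: "peq A k x x" "X = cls (peq A) k x" by (rule P.cellE[OF cX])
    show ?thesis using s[OF x(1)] ext[OF x(1)] proj_rep[OF A x(1)] x(2) by metis
  qed
  show "Q_morphism (freeQ A) Q (N3_ext Q g) E"
    unfolding Q_morphism_def
  proof (intro conjI allI impI ballI; (elim conjE)?)
    show "magma_map (qX (freeQ A)) (qX Q) (N3_ext Q g)" using h by (simp add: freeQ_def)
    show "magma_map (qB (freeQ A)) (qB Q) E" using E by (simp add: freeQ_def)
    show "qf Q k (N3_ext Q g k x) = E k (qf (freeQ A) k x)" if "k \<le> 3" "x \<in> cells (qX (freeQ A)) k" for k x
      using sq that by (simp add: freeQ_def)
    fix k X Y assume k: "(k::nat) < 3" and p: "parallel (qX (freeQ A)) k X Y" and e: "qf (freeQ A) k X = qf (freeQ A) k Y"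
    have p: "parallel ?X k X Y" and e: "proj A (rep X) = proj A (rep Y)" using p e by (simp_all add: freeQ_def)
    from p have c: "X \<in> cells ?X k" "Y \<in> cells ?X k" by (auto simp: parallel_def)
    obtain x y where x: "peq A k x x" "X = cls (peq A) k x" and y: "peq A k y y" "Y = cls (peq A) k y"
      using c by (auto elim!: P.cellE)
    have p': "k = 0 \<or> (peq A (k - 1) (tsrc A x) (tsrc A y) \<and> peq A (k - 1) (ttgt A x) (ttgt A y))"
      using p x y parallel_cls by metis
    have e': "proj A x = proj A y" using e x y proj_rep[OF A] by simp
    have w: "peq A (Suc k) (Con k x y) (Con k x y)" using k x y p' e' by (intro peq.con) auto
    show "N3_ext Q g (Suc k) (qc (freeQ A) k X Y) = qc Q k (N3_ext Q g k X) (N3_ext Q g k Y)"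
      using Pcons[OF A k x(1) y(1) p' e'] x y w by (simp add: ext)
  qed
  fix h e assume qm: "Q_morphism (freeQ A) Q h e" and hg: "\<And>k a. k \<le> 3 \<Longrightarrow> a \<in> cells A k \<Longrightarrow> h k (N3_unit A k a) = g k a"
  have hm: "magma_map ?X (qX Q) h" and em: "magma_map (free_cat A) (qB Q) e"
    and hsq: "\<And>k X. k \<le> 3 \<Longrightarrow> X \<in> cells ?X k \<Longrightarrow> qf Q k (h k X) = e k (proj A (rep X))"
    and hc: "\<And>k X Y. k < 3 \<Longrightarrow> parallel ?X k X Y \<Longrightarrow> proj A (rep X) = proj A (rep Y) \<Longrightarrow> h (Suc k) (qc (freeQ A) k X Y) = qc Q k (h k X) (h k Y)"
    using qm unfolding Q_morphism_def by (simp_all add: freeQ_def)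
  note r = P.map_rules[OF hm] and r' = P.map_rules[OF h]
  have "peq A m x y \<Longrightarrow> h m (cls (peq A) m x) = N3_ext Q g m (cls (peq A) m x) \<and> h m (cls (peq A) m y) = N3_ext Q g m (cls (peq A) m y)" for m x y
  proof (induction rule: peq.induct)
    case (gen k a) then show ?case using hg[OF gen] un[OF gen] by (simp add: N3_unit_def)
  next
    case (src m x y)
    have "peq A (Suc m) x x" "peq A (Suc m) y y" using src(1) P.l P.r by blast+
    then show ?case using src r(1) r'(1) by simp
  next
    case (tgt m x y)
    have "peq A (Suc m) x x" "peq A (Suc m) y y" using tgt(1) P.l P.r by blast+
    then show ?case using tgt r(2) r'(2) by simp
  next
    case (idn k x y)
    have "peq A k x x" "peq A k y y" using idn P.l P.r by blast+
    then show ?case using idn r(3) r'(3) by simp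
  next
    case (cmp k m x x' y y')
    have w: "peq A m x x" "peq A m y y" using cmp P.l by blast+
    have "cls (peq A) m (Cmp m k y x) = cls (peq A) m (Cmp m k y' x')" using peq.cmp[OF cmp.hyps] P.cls_eq P.l by metis
    then show ?case using cmp r(4)[OF cmp(1,2) w cmp(5)] r'(4)[OF cmp(1,2) w cmp(5)] by simp
  next
    case (glob_src m x)
    have "peq A (Suc m) (tsrc A x) (tsrc A x)" "peq A (Suc m) (ttgt A x) (ttgt A x)" using glob_src peq.src peq.tgt by blast+
    then show ?case using glob_src r(1,2) r'(1,2) by simp
  next
    case (glob_tgt m x)
    have "peq A (Suc m) (tsrc A x) (tsrc A x)" "peq A (Suc m) (ttgt A x) (ttgt A x)" using glob_tgt peq.src peq.tgt by blast+
    then show ?case using glob_tgt r(1,2) r'(1,2) by simp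
  next
    case (con k x x' y y')
    have w: "peq A k x x" "peq A k y y" using con.hyps(2,3) P.l by blast+
    have pe: "proj A x = proj A y" by (rule con.hyps(4))
    have p': "k = 0 \<or> (peq A (k - 1) (tsrc A x) (tsrc A y) \<and> peq A (k - 1) (ttgt A x) (ttgt A y))" using con.IH(3) by blast
    note cc = peq.con[OF con.hyps(1,2,3) p' pe]
    note wc = P.l[OF cc]
    have p: "parallel ?X k (cls (peq A) k x) (cls (peq A) k y)" using parallel_cls[OF w] p' by simp
    have pr: "proj A (rep (cls (peq A) k x)) = proj A (rep (cls (peq A) k y))" using pe w proj_rep[OF A] by simp
    have e: "cls (peq A) (Suc k) (Con k x' y') = cls (peq A) (Suc k) (Con k x y)"
      using cc P.cls_eq[OF wc] by metis
    have "h (Suc k) (cls (peq A) (Suc k) (Con k x y)) = N3_ext Q g (Suc k) (cls (peq A) (Suc k) (Con k x y))"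
      using hc[OF con.hyps(1) p pr] Pcons[OF A con.hyps(1) w p' pe] con.IH(1,2) ext[OF wc] ext[OF w(1)] ext[OF w(2)] by simp
    then show ?case by (simp only: e simp_thms)
  next
    case (con_same k x)
    have e: "cls (peq A) (Suc k) (Con k x x) = cls (peq A) (Suc k) (Idn k x)" using peq.con_same[OF con_same(1,2)] P.cls_eq P.l by metis
    show ?case unfolding e using con_same r(3) r'(3) by simp
  qed simp_all
  then show "X \<in> cells (qX (freeQ A)) k \<longrightarrow> h k X = N3_ext Q g k X" for k X by (auto simp: freeQ_def elim!: P.cellE)
  have "e k (free_cat_unit A k a) = E k (free_cat_unit A k a)" if "k \<le> 3" "a \<in> cells A k" for k a
  proof -
    have w: "peq A k (Gen k a) (Gen k a)" using peq.gen[OF that] .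
    have "qf Q k (h k (N3_unit A k a)) = e k (free_cat_unit A k a)"
      using hsq[OF that(1) P.cellI[OF w]] proj_rep[OF A w] by (simp add: N3_unit_def proj_simps)
    then show ?thesis using hg[OF that] E(2)[OF that] by simp
  qed
  then show "X \<in> cells (qB (freeQ A)) k \<longrightarrow> e k X = E k X" for k X
    using free_unique[OF A B, of "{}" e E X k] em E(1) by (simp add: freeQ_def free_cat_def free_cat_unit_def)
qed

theorem free_cat_universal:
  assumes A: "globular A"
  shows "strict_3cat (free_cat A)"
    and "glob_map A (free_cat A) (free_cat_unit A)"
    and "strict_3cat (B :: 'b magma) \<Longrightarrow> glob_map A B g \<Longrightarrow>
      \<exists>h. magma_map (free_cat A) B h \<and>
          (\<forall>k\<le>3. \<forall>a\<in>cells A k. h k (free_cat_unit A k a) = g k a) \<and>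
          (\<forall>h'. magma_map (free_cat A) B h' \<and>
             (\<forall>k\<le>3. \<forall>a\<in>cells A k. h' k (free_cat_unit A k a) = g k a) \<longrightarrow>
             (\<forall>k. \<forall>X\<in>cells (free_cat A) k. h' k X = h k X))"
proof -
  show "strict_3cat (free_cat A)" by (rule free_strict)
  show "glob_map A (free_cat A) (free_cat_unit A)" by (rule free_unit_map[OF A])
  assume B: "strict_3cat B" and g: "glob_map A B g"
  let ?h = "free_ext_map B g"
  have 1: "magma_map (free_cat A) B ?h"
    unfolding free_ext_map_def[abs_def] free_cat_def by (rule free_ext(1)[OF A B g]) simp
  have 2: "?h k (free_cat_unit A k a) = g k a" if "k \<le> 3" "a \<in> cells A k" for k a
    unfolding free_ext_map_def[abs_def] free_cat_unit_def by (rule free_ext(2)[OF A B g _ that]) simp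
  have 3: "h' k X = ?h k X" if h': "magma_map (free_cat A) B h'"
    and e: "\<forall>k\<le>3. \<forall>a\<in>cells A k. h' k (free_cat_unit A k a) = g k a"
    and X: "X \<in> cells (free_cat A) k" for h' k X
    by (rule free_unique[OF A B h'[unfolded free_cat_def] 1[unfolded free_cat_def] _ X[unfolded free_cat_def]])
      (use e 2 in \<open>simp add: free_cat_unit_def\<close>)
  show "\<exists>h. magma_map (free_cat A) B h \<and>
          (\<forall>k\<le>3. \<forall>a\<in>cells A k. h k (free_cat_unit A k a) = g k a) \<and>
          (\<forall>h'. magma_map (free_cat A) B h' \<and>
             (\<forall>k\<le>3. \<forall>a\<in>cells A k. h' k (free_cat_unit A k a) = g k a) \<longrightarrow>
             (\<forall>k. \<forall>X\<in>cells (free_cat A) k. h' k X = h k X))"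
    by (intro exI[of _ ?h] conjI allI impI ballI) (use 1 2 3 in blast)+
qed

theorem free_cat_refl_universal:
  fixes R :: "'a rglob" and B :: "'b magma"
  assumes R: "reflexive_globular R"
  defines "reflmap \<equiv> \<lambda>(C :: 'b magma) g. glob_map R C g \<and>
     (\<forall>k<3. \<forall>a\<in>cells R k. g (Suc k) (idn R k a) = idn C k (g k a))"
  shows "strict_3cat (free_cat_refl R)"
    and "glob_map R (free_cat_refl R) (free_cat_refl_unit R)"
    and "\<And>k a. k < 3 \<Longrightarrow> a \<in> cells R k \<Longrightarrow>
      free_cat_refl_unit R (Suc k) (idn R k a) = idn (free_cat_refl R) k (free_cat_refl_unit R k a)"
    and "strict_3cat B \<Longrightarrow> reflmap B g \<Longrightarrow>
      \<exists>h. magma_map (free_cat_refl R) B h \<and>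
          (\<forall>k\<le>3. \<forall>a\<in>cells R k. h k (free_cat_refl_unit R k a) = g k a) \<and>
          (\<forall>h'. magma_map (free_cat_refl R) B h' \<and>
             (\<forall>k\<le>3. \<forall>a\<in>cells R k. h' k (free_cat_refl_unit R k a) = g k a) \<longrightarrow>
             (\<forall>k. \<forall>X\<in>cells (free_cat_refl R) k. h' k X = h k X))"
proof -
  let ?A = "uglob R" and ?I = "idn_pairs R"
  have A: "globular ?A" using R by (simp add: reflexive_globular_def globular_def uglob_def)
  have cA: "cells ?A = cells R" by (simp add: uglob_def)
  show "strict_3cat (free_cat_refl R)" unfolding free_cat_refl_def by (rule term_strict)
  show "glob_map R (free_cat_refl R) (free_cat_refl_unit R)"
    using term_unit_map[OF A, of ?I] unfolding free_cat_refl_def free_cat_refl_unit_def[abs_def]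
    by (simp add: glob_map_def uglob_def)
  show "free_cat_refl_unit R (Suc k) (idn R k a) = idn (free_cat_refl R) k (free_cat_refl_unit R k a)"
    if k: "k < 3" and a: "a \<in> cells R k" for k a
  proof -
    have w: "teq ?A ?I k (Gen k a) (Gen k a)" using k a by (intro teq.gen) (simp_all add: cA)
    have "idn R k a \<in> cells R (Suc k)" using R k a by (simp add: reflexive_globular_def)
    then have e: "teq ?A ?I (Suc k) (Gen (Suc k) (idn R k a)) (Idn k (Gen k a))"
      using k a by (intro teq.gen_idn) (auto simp: cA idn_pairs_def)
    show ?thesis unfolding free_cat_refl_def free_cat_refl_unit_def
      using T.Qidn[OF k w] e T.cls_eq[OF T.l[OF e]] by metis
  qed
  assume B: "strict_3cat B" and gr: "reflmap B g"
  let ?h = "free_ext_map B g"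
  have g: "glob_map ?A B g" using gr by (simp add: reflmap_def glob_map_def uglob_def)
  have I: "g (Suc k) b = idn B k (g k a)" if "(k, a, b) \<in> ?I" for k a b
    using that gr by (auto simp: idn_pairs_def reflmap_def)
  have 1: "magma_map (free_cat_refl R) B ?h"
    unfolding free_ext_map_def[abs_def] free_cat_refl_def by (rule free_ext(1)[OF A B g I])
  have 2: "?h k (free_cat_refl_unit R k a) = g k a" if "k \<le> 3" "a \<in> cells R k" for k a
    unfolding free_ext_map_def[abs_def] free_cat_refl_unit_def
    by (rule free_ext(2)[OF A B g I]) (use that in \<open>simp_all add: cA\<close>)
  have 3: "h' k X = ?h k X" if h': "magma_map (free_cat_refl R) B h'"
    and e: "\<forall>k\<le>3. \<forall>a\<in>cells R k. h' k (free_cat_refl_unit R k a) = g k a"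
    and X: "X \<in> cells (free_cat_refl R) k" for h' k X
    by (rule free_unique[OF A B h'[unfolded free_cat_refl_def] 1[unfolded free_cat_refl_def] _
          X[unfolded free_cat_refl_def]])
      (use e 2 in \<open>simp add: free_cat_refl_unit_def cA\<close>)
  show "\<exists>h. magma_map (free_cat_refl R) B h \<and>
          (\<forall>k\<le>3. \<forall>a\<in>cells R k. h k (free_cat_refl_unit R k a) = g k a) \<and>
          (\<forall>h'. magma_map (free_cat_refl R) B h' \<and>
             (\<forall>k\<le>3. \<forall>a\<in>cells R k. h' k (free_cat_refl_unit R k a) = g k a) \<longrightarrow>
             (\<forall>k. \<forall>X\<in>cells (free_cat_refl R) k. h' k X = h k X))"
    by (intro exI[of _ ?h] conjI allI impI ballI) (use 1 2 3 in blast)+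
qed

end

theory Submission
  imports Defs
begin

text \<open>Inequalities in TA are detected by a functor to the strict 3-category of words: its
  1-cells are the natural numbers, its 2-cells on n are the n-tuples of words over the alphabet A(2),
  composed vertically by entrywise concatenation and horizontally by juxtaposition, and its
  3-cells are codiscrete.  The generating 1-cell goes to 1 and the identity to 0, a horizontal
  composite of generating 2-cells lies over 2 and a vertical one over 1, and vertical composition of
  distinct generators does not commute.  Conversely, a property of cells of TA that holds for
  the generators and is closed under the operations holds for all cells, because a retraction onto a
  sub-3-category containing the generators is the identity by freeness.\<close>

section \<open>The strict 3-category of words\<close>

definition pointwise :: "'a list list \<Rightarrow> 'a list list \<Rightarrow> 'a list list" where
  "pointwise q p = map2 (@) q p"

lemma length_pointwise [simp]: "length (pointwise q p) = min (length q) (length p)"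
  by (simp add: pointwise_def)

text \<open>Since \<open>map2\<close> truncates to the shorter list, this holds for tuples of any
  lengths, and associativity in \<open>word_cat\<close> can be verified on arbitrary pairs of
  tuples.\<close>

lemma pointwise_assoc: "pointwise (pointwise r q) p = pointwise r (pointwise q p)"
  by (rule nth_equalityI) (simp_all add: pointwise_def)

lemma pointwise_blank [simp]:
  "length p = n \<Longrightarrow> pointwise p (replicate n []) = p"
  "length p = n \<Longrightarrow> pointwise (replicate n []) p = p"
  by (rule nth_equalityI; simp add: pointwise_def)+

text \<open>This is interchange of horizontal and vertical composition: the length condition,
  supplied later by composability along 1-cells, makes both juxtapositions split at the same
  place.\<close>

lemma pointwise_append:
  "length q = length p \<Longrightarrow> pointwise (q @ q') (p @ p') = pointwise q p @ pointwise q' p'"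
  by (simp add: pointwise_def)

text \<open>To fit all dimensions into one type, an m-cell is the pair of 2-cells (lists of words) that are
  its 2-dimensional source and target; below dimension 3 the two agree, and the 1-cell n is the
  list of n empty words, that is, its own identity 2-cell.\<close>

definition word_cat :: "('a list list \<times> 'a list list) magma" where
  "word_cat =
     \<lparr>cells = (\<lambda>k. if k = 0 then {([], [])}
                   else if k = 1 then {(replicate n [], replicate n []) | n. True}
                   else if k = 2 then {(p, p) | p. True}
                   else if k = 3 then {(p, q). length p = length q}
                   else {}),
      src = (\<lambda>k (p, q). if k = 3 then (p, p)
                   else if k = 2 then (replicate (length p) [], replicate (length p) [])
                   else ([], [])),
      tgt = (\<lambda>k (p, q). if k = 3 then (q, q)
                   else if k = 2 then (replicate (length p) [], replicate (length p) [])
                   else ([], [])),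
      idn = (\<lambda>k X. X),
      cmp = (\<lambda>m k (q, q') (p, p').
               if k = 0 then (q @ p, q' @ p')
               else if k = 1 then (pointwise q p, pointwise q' p')
               else (p, q'))\<rparr>"

text \<open>Composition laws are checked over these six pairs; the \<open>Suc\<close> form lets the
  recursions of \<open>src_to\<close>, \<open>tgt_to\<close> and \<open>idn_to\<close> unfold by
  simplification.\<close>

lemma dim_cases:
  assumes "k < m" "m \<le> (3::nat)"
  obtains "m = Suc 0" "k = 0" | "m = Suc (Suc 0)" "k = 0" | "m = Suc (Suc 0)" "k = Suc 0"
    | "m = Suc (Suc (Suc 0))" "k = 0" | "m = Suc (Suc (Suc 0))" "k = Suc 0"
    | "m = Suc (Suc (Suc 0))" "k = Suc (Suc 0)"
  using assms by (auto simp: numeral_3_eq_3 le_Suc_eq less_Suc_eq)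

lemma word_simps:
  "X \<in> cells word_cat 0 \<longleftrightarrow> X = ([], [])"
  "X \<in> cells word_cat (Suc 0) \<longleftrightarrow> (\<exists>n. X = (replicate n [], replicate n []))"
  "X \<in> cells word_cat (Suc (Suc 0)) \<longleftrightarrow> (\<exists>p. X = (p, p))"
  "X \<in> cells word_cat (Suc (Suc (Suc 0))) \<longleftrightarrow> (\<exists>p q. X = (p, q) \<and> length p = length q)"
  "src word_cat (Suc 0) (p, q) = ([], [])"
  "tgt word_cat (Suc 0) (p, q) = ([], [])"
  "src word_cat (Suc (Suc 0)) (p, q) = (replicate (length p) [], replicate (length p) [])"
  "tgt word_cat (Suc (Suc 0)) (p, q) = (replicate (length p) [], replicate (length p) [])"
  "src word_cat (Suc (Suc (Suc 0))) (p, q) = (p, p)"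
  "tgt word_cat (Suc (Suc (Suc 0))) (p, q) = (q, q)"
  "idn word_cat k X = X"
  "cmp word_cat m 0 (q, q') (p, p') = (q @ p, q' @ p')"
  "cmp word_cat m (Suc 0) (q, q') (p, p') = (pointwise q p, pointwise q' p')"
  "cmp word_cat m (Suc (Suc 0)) (q, q') (p, p') = (p, q')"
  by (auto simp: word_cat_def)

lemma replicate_append_replicate: "replicate m x @ replicate n x = replicate (m + n) x"
  by (simp add: replicate_add)

lemma all_less_3: "(\<forall>k<3. P k) \<longleftrightarrow> P 0 \<and> P (Suc 0) \<and> P (Suc (Suc 0))"
  by (auto simp: numeral_3_eq_3 less_Suc_eq)

lemma all_less_2: "(\<forall>k<2. P k) \<longleftrightarrow> P 0 \<and> P (Suc 0)"
  by (auto simp: numeral_2_eq_2 less_Suc_eq)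

text \<open>The 1-dimensional boundary of a tuple is its length: lengths add under juxtaposition and
  are kept by entrywise concatenation of composable tuples. A 3-cell is nothing but its
  boundary.\<close>

lemma word_magma: "is_magma (word_cat :: ('a list list \<times> 'a list list) magma)" (is "is_magma ?W")
proof -
  have "globular ?W"
    unfolding globular_def all_less_3 all_less_2 by (auto simp: word_simps)
  then have "reflexive_globular ?W"
    unfolding reflexive_globular_def all_less_3 by (auto simp: word_simps)
  moreover have "cmp ?W (Suc m) k y x \<in> cells ?W (Suc m) \<and>
           src ?W (Suc m) (cmp ?W (Suc m) k y x) =
             (if k = m then src ?W (Suc m) x
              else cmp ?W m k (src ?W (Suc m) y) (src ?W (Suc m) x)) \<and>
           tgt ?W (Suc m) (cmp ?W (Suc m) k y x) =
             (if k = m then tgt ?W (Suc m) y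
              else cmp ?W m k (tgt ?W (Suc m) y) (tgt ?W (Suc m) x))"
    if k: "k \<le> m" and m: "m < 3" and x: "x \<in> cells ?W (Suc m)" and y: "y \<in> cells ?W (Suc m)"
      and e: "tgt_to ?W k (Suc m) x = src_to ?W k (Suc m) y" for m k x y
  proof -
    have "k < Suc m" "Suc m \<le> 3" using k m by simp_all
    then show ?thesis
    proof (cases rule: dim_cases)
    qed (use x y e in \<open>auto simp: word_simps replicate_append_replicate\<close>)
  qed
  ultimately show ?thesis unfolding is_magma_def by blast
qed

text \<open>Composition of 3-cells along 0- and 1-cells acts on both components as for 2-cells, and
  composition along 2-cells keeps the outer boundary. So the only substantial law is interchange of
  tuples, \<open>pointwise_append\<close>.\<close>

lemma word_strict: "strict_3cat (word_cat :: ('a list list \<times> 'a list list) magma)" (is "strict_3cat ?W")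
  unfolding strict_3cat_def
proof (intro conjI allI impI ballI; (elim conjE)?)
  show "is_magma ?W" by (rule word_magma)
next
  fix m k :: nat and x y z :: "'a list list \<times> 'a list list"
  show "cmp ?W m k (cmp ?W m k z y) x = cmp ?W m k z (cmp ?W m k y x)"
    by (cases x, cases y, cases z) (simp add: word_cat_def pointwise_assoc)
next
  fix m k :: nat and x :: "'a list list \<times> 'a list list"
  assume a: "k < m" "m \<le> 3" "x \<in> cells ?W m"
  show "cmp ?W m k x (idn_to ?W k m (src_to ?W k m x)) = x"
    using a(1,2) by (cases rule: dim_cases) (use a(3) in \<open>auto simp: word_simps\<close>)
  show "cmp ?W m k (idn_to ?W k m (tgt_to ?W k m x)) x = x"
    using a(1,2) by (cases rule: dim_cases) (use a(3) in \<open>auto simp: word_simps\<close>)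
next
  fix m l k :: nat and x y z w :: "'a list list \<times> 'a list list"
  assume a: "k < l" "l < m" "m \<le> 3"
    and c: "x \<in> cells ?W m" "y \<in> cells ?W m" "z \<in> cells ?W m" "w \<in> cells ?W m"
    and e: "tgt_to ?W l m x = src_to ?W l m y" "tgt_to ?W l m z = src_to ?W l m w"
      "tgt_to ?W k m x = src_to ?W k m z"
  consider "m = Suc (Suc 0)" "l = Suc 0" "k = 0"
    | "m = Suc (Suc (Suc 0))" "l = Suc 0" "k = 0"
    | "m = Suc (Suc (Suc 0))" "l = Suc (Suc 0)" "k = 0"
    | "m = Suc (Suc (Suc 0))" "l = Suc (Suc 0)" "k = Suc 0"
    using a by linarith
  then show "cmp ?W m k (cmp ?W m l w z) (cmp ?W m l y x) =
      cmp ?W m l (cmp ?W m k w y) (cmp ?W m k z x)"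
    by cases (use c e in \<open>auto simp: word_simps pointwise_append\<close>)
next
  fix m k :: nat and x y :: "'a list list \<times> 'a list list"
  show "cmp ?W (Suc m) k (idn ?W m y) (idn ?W m x) = idn ?W m (cmp ?W m k y x)"
    by (cases x, cases y) (simp add: word_cat_def)
qed

text \<open>A generating 2-cell becomes a tuple with one entry, a one-letter word. The value on a
  generating 3-cell is forced by its boundary.\<close>

definition word_gen :: "'a glob \<Rightarrow> nat \<Rightarrow> 'a \<Rightarrow> 'a list list \<times> 'a list list" where
  "word_gen A k a =
     (if k = 0 then ([], [])
      else if k = 1 then ([[]], [[]])
      else if k = 2 then ([[a]], [[a]])
      else ([[src A 3 a]], [[tgt A 3 a]]))"

text \<open>Each generating 2-cell goes to a one-entry tuple, whose source and target are both the
  1-cell 1, the image of every generating 1-cell.\<close>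

lemma glob_map_word_gen: "glob_map A word_cat (word_gen A)"
proof -
  have *: "\<exists>n. [[]] = replicate n ([] :: 'a list)"
    by (rule exI[of _ 1]) simp
  have "word_gen A k a \<in> cells word_cat k" if "k \<le> 3" for k a
  proof -
    have "k = 0 \<or> k = Suc 0 \<or> k = Suc (Suc 0) \<or> k = Suc (Suc (Suc 0))"
      using that by (auto simp: numeral_3_eq_3 le_Suc_eq)
    then show ?thesis
      by (elim disjE) (simp_all add: word_gen_def word_simps numeral_2_eq_2 *)
  qed
  then show ?thesis
    unfolding glob_map_def all_less_3 by (auto simp: word_gen_def word_simps numeral_3_eq_3)
qed

text \<open>The tool for telling cells of TA apart: \<open>h\<close> is known on generators and can
  be computed on their composites.\<close>

lemma free_cat_to_words:
  assumes "globular A"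
  obtains h where "magma_map (free_cat A) word_cat h"
    "\<And>k a. k \<le> 3 \<Longrightarrow> a \<in> cells A k \<Longrightarrow> h k (free_cat_unit A k a) = word_gen A k a"
  using free_cat_universal(3)[OF assms word_strict glob_map_word_gen] by blast

section \<open>Generation of the free strict 3-category\<close>

lemma bd_to_cells_update [simp]:
  "src_to (M\<lparr>cells := S\<rparr>) k m x = src_to M k m x"
  "tgt_to (M\<lparr>cells := S\<rparr>) k m x = tgt_to M k m x"
  by (induction m arbitrary: x) auto

lemma idn_to_cells_update [simp]: "idn_to (M\<lparr>cells := S\<rparr>) k m x = idn_to M k m x"
  by (induction m) auto

text \<open>The axioms are universally quantified equations, so they restrict to any family of cells
  closed under the operations.\<close>

lemma strict_3cat_sub:
  fixes M :: "'b magma"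
  assumes M: "strict_3cat M"
    and sub: "\<And>k. S k \<subseteq> cells M k"
    and bd: "\<And>k a. k < 3 \<Longrightarrow> a \<in> S (Suc k) \<Longrightarrow> src M (Suc k) a \<in> S k \<and> tgt M (Suc k) a \<in> S k"
    and idn: "\<And>k a. k < 3 \<Longrightarrow> a \<in> S k \<Longrightarrow> idn M k a \<in> S (Suc k)"
    and cmp: "\<And>k m x y. k < m \<Longrightarrow> m \<le> 3 \<Longrightarrow> x \<in> S m \<Longrightarrow> y \<in> S m \<Longrightarrow>
      tgt_to M k m x = src_to M k m y \<Longrightarrow> cmp M m k y x \<in> S m"
  shows "strict_3cat (M\<lparr>cells := S\<rparr>)"
proof -
  have c: "a \<in> cells M k" if "a \<in> S k" for a k using sub that by blast
  note mag = strict_magma[OF M]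
  have "globular (M\<lparr>cells := S\<rparr>)"
    using bd globD2[OF magma_glob[OF mag]] c by (simp add: globular_def)
  then have "reflexive_globular (M\<lparr>cells := S\<rparr>)"
    using idn idnD[OF mag] c by (simp add: reflexive_globular_def)
  then have "is_magma (M\<lparr>cells := S\<rparr>)"
    using cmp magmaD(2,3)[OF mag] c by (simp add: is_magma_def)
  then show ?thesis
    using strictD[OF M] c unfolding strict_3cat_def by simp
qed

text \<open>Induction on cells rather than on representing terms. \<open>?S\<close> is the
  sub-3-category of the cells satisfying \<open>P\<close>; as it contains the generators, the
  universal property maps TA into it.\<close>

lemma free_cat_induct:
  assumes A: "globular A" and X: "X \<in> cells (free_cat A) k"
    and gen: "\<And>k a. k \<le> 3 \<Longrightarrow> a \<in> cells A k \<Longrightarrow> P k (free_cat_unit A k a)"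
    and bd: "\<And>k X. k < 3 \<Longrightarrow> X \<in> cells (free_cat A) (Suc k) \<Longrightarrow> P (Suc k) X \<Longrightarrow>
      P k (src (free_cat A) (Suc k) X) \<and> P k (tgt (free_cat A) (Suc k) X)"
    and idn: "\<And>k X. k < 3 \<Longrightarrow> X \<in> cells (free_cat A) k \<Longrightarrow> P k X \<Longrightarrow> P (Suc k) (idn (free_cat A) k X)"
    and cmp: "\<And>k m X Y. k < m \<Longrightarrow> m \<le> 3 \<Longrightarrow> X \<in> cells (free_cat A) m \<Longrightarrow> Y \<in> cells (free_cat A) m \<Longrightarrow>
      P m X \<Longrightarrow> P m Y \<Longrightarrow> tgt_to (free_cat A) k m X = src_to (free_cat A) k m Y \<Longrightarrow>
      P m (cmp (free_cat A) m k Y X)"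
  shows "P k X"
proof -
  let ?T = "free_cat A"
  let ?S = "?T\<lparr>cells := \<lambda>k. {X \<in> cells ?T k. P k X}\<rparr>"
  note T = free_strict[of A]
  note mag = strict_magma[OF T]
  note unit = free_unit_map[OF A]
  have S: "strict_3cat ?S"
    by (rule strict_3cat_sub[OF T])
       (use bd idn cmp globD[OF magma_glob[OF mag]] idnD[OF mag] magma_cmp_cell[OF mag] in auto)
  have "glob_map A ?S (free_cat_unit A)"
    using unit gen by (simp add: glob_map_def)
  from free_cat_universal(3)[OF A S this] obtain h where h: "magma_map ?T ?S h"
    and hu: "\<forall>k\<le>3. \<forall>a\<in>cells A k. h k (free_cat_unit A k a) = free_cat_unit A k a" by blast
  \<comment> \<open>Followed by the inclusion of \<open>?S\<close>, the functor \<open>h\<close> is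
    an endofunctor of TA fixing the generators; uniqueness makes it the identity, so every cell
    already lies in \<open>?S\<close>.\<close>
  have h': "magma_map ?T ?T h"
    using h by (simp add: magma_map_def glob_map_def)
  have i: "magma_map ?T ?T (\<lambda>_ X. X)"
    by (simp add: magma_map_def glob_map_def)
  have "h k X = X"
    using free_unique[OF A T, of "{}" h "\<lambda>_ X. X" X k] h' i hu X
    by (simp add: free_cat_def free_cat_unit_def)
  \<comment> \<open>A globular map is constrained only up to dimension 3, so the absence of higher
    cells in TA is needed to conclude that \<open>h k X\<close> lies in \<open>?S\<close>.\<close>
  moreover have "k \<le> 3" using X T.cells0 unfolding free_cat_def by (metis empty_iff not_le)
  ultimately show ?thesis using h X by (force simp: magma_map_def glob_map_def)
qed

lemma generated_1cells_sub:
  assumes "is_magma C" "G \<subseteq> cells C 1"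
  shows "generated_1cells C G \<subseteq> cells C 1"
proof
  fix f assume "f \<in> generated_1cells C G"
  then show "f \<in> cells C 1"
  proof induction
    case (gen f) then show ?case using assms by blast
  next
    case (idn x) then show ?case using idnD(1)[OF assms(1), of 0] by simp
  next
    case (cmp f g) then show ?case using magmaD(1)[OF assms(1), of 0 0 f g] by simp
  qed
qed

text \<open>The induction passes through all dimensions, since 1-cells also arise as boundaries. The
  claim is therefore strengthened to \<open>?P\<close>: every cell of positive dimension has
  generated 1-dimensional source and target.\<close>

lemma generated_1cells_free_cat:
  assumes A: "globular A"
  shows "generated_1cells (free_cat A) (free_cat_unit A 1 ` cells A 1) = cells (free_cat A) 1"
    (is "?G = _")
proof
  let ?T = "free_cat A"
  note mag = strict_magma[OF free_strict[of A]]
  note G = magma_glob[OF mag]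
  show "?G \<subseteq> cells ?T 1"
    using free_unit_map[OF A] by (intro generated_1cells_sub[OF mag]) (auto simp: glob_map_def)
  let ?P = "\<lambda>k X. k = 0 \<or> src_to ?T 1 k X \<in> ?G \<and> tgt_to ?T 1 k X \<in> ?G"
  have unit: "src_to ?T 1 k (free_cat_unit A k a) = free_cat_unit A 1 (src_to A 1 k a) \<and>
      tgt_to ?T 1 k (free_cat_unit A k a) = free_cat_unit A 1 (tgt_to A 1 k a)"
    if "1 \<le> k" "k \<le> 3" "a \<in> cells A k" for k a
    using that
  proof (induction k arbitrary: a)
    case (Suc k)
    have *: "src ?T (Suc k) (free_cat_unit A (Suc k) a) = free_cat_unit A k (src A (Suc k) a)"
      "tgt ?T (Suc k) (free_cat_unit A (Suc k) a) = free_cat_unit A k (tgt A (Suc k) a)"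
      using free_unit_map[OF A] Suc.prems by (auto simp: glob_map_def)
    show ?case
      using * Suc.IH globD[OF A Suc.prems(2,3)] Suc.prems by (cases "k = 0") auto
  qed simp
  show "cells ?T 1 \<subseteq> ?G"
  proof
    fix X assume X: "X \<in> cells ?T 1"
    have "?P 1 X"
    proof (rule free_cat_induct[OF A X, of ?P])
      fix k a assume "k \<le> 3" "a \<in> cells A k"
      then show "?P k (free_cat_unit A k a)"
        using unit[of k a] bd_to_cells[OF A, of k 1 a]
        by (cases "k = 0") (auto intro!: generated_1cells.gen)
    next
      fix k X assume "k < 3" "X \<in> cells ?T (Suc k)" "?P (Suc k) X"
      then show "?P k (src ?T (Suc k) X) \<and> ?P k (tgt ?T (Suc k) X)"
        using to_to[OF G, of 1 k "Suc k" X] by (cases "k \<le> 1") (auto simp: le_Suc_eq)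
    next
      fix k X assume "k < 3" "X \<in> cells ?T k" "?P k X"
      then show "?P (Suc k) (idn ?T k X)"
        using idnD[OF mag, of k X] by (cases "k = 0") (auto intro: generated_1cells.idn)
    next
      fix k m X Y
      assume a: "k < m" "m \<le> 3" "X \<in> cells ?T m" "Y \<in> cells ?T m" "?P m X" "?P m Y"
        "tgt_to ?T k m X = src_to ?T k m Y"
      show "?P m (cmp ?T m k Y X)"
      proof (cases "k = 0")
        case True
        \<comment> \<open>Only composition along a 0-cell composes the 1-dimensional boundaries, and
          globularity makes these composable. Along a higher cell, they are inherited from one of
          the two factors.\<close>
        have "tgt_to ?T 0 m X = tgt ?T 1 (src_to ?T 1 m X)" "tgt_to ?T 0 m X = tgt ?T 1 (tgt_to ?T 1 m X)"
          "src_to ?T 0 m Y = src ?T 1 (src_to ?T 1 m Y)" "src_to ?T 0 m Y = src ?T 1 (tgt_to ?T 1 m Y)"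
          using to_to[OF G, of 0 1 m] a True by simp_all
        then show ?thesis
          using a True cmp_to[OF mag a(1-4,7), of 1] by (auto intro!: generated_1cells.cmp[unfolded One_nat_def])
      qed (use a cmp_to[OF mag a(1-4,7), of 1] in auto)
    qed
    then show "X \<in> ?G" by simp
  qed
qed

section \<open>Algebras from objects of Q\<close>

lemma magma_map_to:
  assumes h: "magma_map M N h"
    and M: "globular M"
  shows "k \<le> m \<Longrightarrow> m \<le> 3 \<Longrightarrow> x \<in> cells M m \<Longrightarrow>
    h k (src_to M k m x) = src_to N k m (h m x) \<and> h k (tgt_to M k m x) = tgt_to N k m (h m x)"
proof (induction m arbitrary: x)
  case (Suc m)
  have *: "h m (src M (Suc m) x) = src N (Suc m) (h (Suc m) x)"
    "h m (tgt M (Suc m) x) = tgt N (Suc m) (h (Suc m) x)"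
    using h Suc.prems by (auto simp: magma_map_def glob_map_def)
  show ?case using * Suc.IH Suc.prems globD[OF M Suc.prems(2,3)] by (cases "k = Suc m") auto
qed simp

lemma glob_map_comp:
  "glob_map L M g \<Longrightarrow> glob_map M N h \<Longrightarrow> glob_map L N (\<lambda>k x. h k (g k x))"
  by (simp add: glob_map_def)

lemma magma_map_comp:
  assumes "globular L" "magma_map L M g" "magma_map M N h"
  shows "magma_map L N (\<lambda>k x. h k (g k x))"
proof -
  have g: "glob_map L M g" using assms(2) by (simp add: magma_map_def)
  have gc: "g k x \<in> cells M k" if "k \<le> 3" "x \<in> cells L k" for k x
    using g that by (simp add: glob_map_def)
  have "h m (g m (cmp L m k y x)) = cmp N m k (h m (g m y)) (h m (g m x))"
    if a: "k < m" "m \<le> 3" "x \<in> cells L m" "y \<in> cells L m" "tgt_to L k m x = src_to L k m y" for m k x y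
  proof -
    \<comment> \<open>Maps preserve only composites of composable cells, so \<open>h\<close> applies
      once the images under \<open>g\<close> are known to be composable.\<close>
    have "tgt_to M k m (g m x) = src_to M k m (g m y)"
      using magma_map_to[OF assms(2,1), of k m x] magma_map_to[OF assms(2,1), of k m y] a by simp
    then show ?thesis using assms(2,3) a gc by (simp add: magma_map_def)
  qed
  moreover have "h (Suc k) (g (Suc k) (idn L k x)) = idn N k (h k (g k x))"
    if "k < 3" "x \<in> cells L k" for k x
    using assms(2,3) gc that by (simp add: magma_map_def)
  ultimately show ?thesis
    using glob_map_comp[OF g, of N h] assms(3) by (simp add: magma_map_def)
qed

lemma Q_morphism_comp:
  assumes P: "Q_object P" and g: "Q_morphism P Q g g'" and h: "Q_morphism Q R h h'"
  shows "Q_morphism P R (\<lambda>k x. h k (g k x)) (\<lambda>k x. h' k (g' k x))"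
proof -
  have gl: "globular (qX P)" "globular (qB P)"
    using P by (auto simp: Q_object_def strict_magma magma_glob)
  have gm: "glob_map (qX P) (qX Q) g" using g by (simp add: Q_morphism_def magma_map_def)
  have gc: "g k x \<in> cells (qX Q) k" if "k \<le> 3" "x \<in> cells (qX P) k" for k x
    using gm that by (simp add: glob_map_def)
  have "h (Suc k) (g (Suc k) (qc P k x y)) = qc R k (h k (g k x)) (h k (g k y))"
    if k: "k < 3" and p: "parallel (qX P) k x y" and e: "qf P k x = qf P k y" for k x y
  proof -
    have c: "x \<in> cells (qX P) k" "y \<in> cells (qX P) k" using p by (auto simp: parallel_def)
    \<comment> \<open>Contraction cells exist only over parallel cells with equal projection, so
      \<open>g\<close> must be shown to preserve both conditions before \<open>h\<close> can be
      applied.\<close>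
    have "parallel (qX Q) k (g k x) (g k y)"
    proof (cases k)
      case 0 then show ?thesis using c gc by (simp add: parallel_def)
    next
      case (Suc n)
      then have "\<forall>z\<in>cells (qX P) k. src (qX Q) k (g k z) = g n (src (qX P) k z) \<and>
          tgt (qX Q) k (g k z) = g n (tgt (qX P) k z)"
        using gm k by (simp add: glob_map_def)
      then show ?thesis using c gc k p Suc by (simp add: parallel_def)
    qed
    moreover have "qf Q k (g k x) = qf Q k (g k y)"
      using g c e k by (simp add: Q_morphism_def)
    ultimately show ?thesis using g h k p e unfolding Q_morphism_def by metis
  qed
  moreover have "qf R k (h k (g k x)) = h' k (g' k (qf P k x))"
    if "k \<le> 3" "x \<in> cells (qX P) k" for k x
    using g h gc that by (simp add: Q_morphism_def)
  ultimately show ?thesis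
    using magma_map_comp[OF gl(1), of "qX Q" g "qX R" h] magma_map_comp[OF gl(2), of "qB Q" g' "qB R" h'] g h
    by (simp add: Q_morphism_def)
qed

lemma globular_uglob [simp]: "globular (uglob A) \<longleftrightarrow> globular A"
  by (simp add: globular_def uglob_def)

lemma glob_map_uglob [simp]:
  "glob_map (uglob A) B h \<longleftrightarrow> glob_map A B h"
  "glob_map A (uglob B) h \<longleftrightarrow> glob_map A B h"
  by (simp_all add: glob_map_def uglob_def)

lemma cells_uglob [simp]: "cells (uglob A) = cells A"
  by (simp add: uglob_def)

text \<open>Both sides of the associativity law extend \<open>\<theta>\<close> to a Q-morphism on the free object,
  so they agree by uniqueness.\<close>

theorem Q_object_N3_algebra:
  fixes Q :: "('x, 'b) qobj"
  assumes Q: "Q_object Q"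
  shows "N3_algebra (uglob (qX Q)) (N3_ext Q (\<lambda>_ x. x))"
proof -
  define A where "A = uglob (qX Q)"
  define \<theta> where "\<theta> = N3_ext Q (\<lambda>_ x. x)"
  define N where "N = N3 A"
  have A: "globular A"
    using Q by (simp add: A_def Q_object_def magma_glob)
  have N: "globular N"
    unfolding N_def N3_def using freeQ_object[OF A] by (simp add: Q_object_def magma_glob)
  have idA: "glob_map A (qX Q) (\<lambda>_ x. x)" by (simp add: A_def glob_map_def uglob_def)
  note uA = N3_universal[OF A Q idA, folded \<theta>_def]
  obtain e where \<theta>: "Q_morphism (freeQ A) Q \<theta> e" using uA(1) by blast
  have \<theta>u: "\<theta> k (N3_unit A k a) = a" if "k \<le> 3" "a \<in> cells A k" for k a
    using uA(2) that by blast
  have \<theta>g: "glob_map N A \<theta>"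
    using \<theta> by (simp add: N_def N3_def A_def Q_morphism_def magma_map_def)
  have \<theta>g': "glob_map N (qX Q) \<theta>" using \<theta>g by (simp add: A_def)
  have unit: "glob_map A (qX (freeQ A)) (N3_unit A)"
    using P_unit_map[OF A] by (simp add: freeQ_def)
  have idN: "glob_map N (qX (freeQ A)) (\<lambda>_ X. X)" by (simp add: N_def N3_def glob_map_def uglob_def)
  \<comment> \<open>\<open>uM\<close> presents \<open>N3_map A \<theta>\<close> as the extension of
    the unit after \<open>\<theta>\<close>, and \<open>um\<close> presents \<open>N3_mult A\<close>
    as the extension of the identity on \<open>N\<close>.\<close>
  note uM = N3_universal[OF N freeQ_object[OF A] glob_map_comp[OF \<theta>g unit]]
  note um = N3_universal[OF N freeQ_object[OF A] idN]
  note u\<theta> = N3_universal(3)[OF N Q \<theta>g']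
  note 1 = Q_morphism_comp[OF freeQ_object[OF N] uM(1) \<theta>]
  note 2 = Q_morphism_comp[OF freeQ_object[OF N] um(1) \<theta>]
  have c: "\<theta> k X \<in> cells A k" if "k \<le> 3" "X \<in> cells N k" for k X
    using \<theta>g that by (simp add: glob_map_def)
  have "\<theta> k (N3_map A \<theta> k X) = \<theta> k (N3_mult A k X)" if X: "X \<in> cells (N3 N) k" for k X
  proof -
    have X': "X \<in> cells (qX (freeQ N)) k" using X by (simp add: N3_def)
    \<comment> \<open>On generators, this side is \<open>\<theta>\<close> after the unit after
      \<open>\<theta>\<close>, which is \<open>\<theta>\<close> by the unit law. The other side
      restricts to \<open>\<theta>\<close> directly.\<close>
    have "\<theta> k (N3_map A \<theta> k X) = N3_ext Q \<theta> k X"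
      unfolding N3_map_def by (rule u\<theta>[OF 1, THEN mp, OF _ X']) (simp add: uM(2) \<theta>u c)
    moreover have "\<theta> k (N3_mult A k X) = N3_ext Q \<theta> k X"
      unfolding N3_mult_def by (rule u\<theta>[OF 2, THEN mp, OF _ X']) (simp add: um(2))
    ultimately show ?thesis by simp
  qed
  then show ?thesis
    using A \<theta>g \<theta>u unfolding N3_algebra_def A_def[symmetric] \<theta>_def[symmetric] N_def by blast
qed

text \<open>Cells with the same image under the identity map are equal, so identities form a
  contraction. Every strict 3-category thus carries an \<open>N3\<close>-algebra structure.\<close>

lemma strict_Q_object:
  assumes B: "strict_3cat B"
  shows "Q_object \<lparr>qX = B, qB = B, qf = \<lambda>_ x. x, qc = \<lambda>k x _. idn B k x\<rparr>"
  using B strict_magma[OF B] idnD[OF strict_magma[OF B]]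
  by (auto simp: Q_object_def magma_map_def glob_map_def contraction_def parallel_def)

text \<open>The additive monoid of naturals as the 2-cells on a unique 1-cell, with only identity
  3-cells.\<close>

definition nat_cat :: "nat magma" where
  "nat_cat =
     \<lparr>cells = (\<lambda>k. if k \<le> 1 then {0} else UNIV),
      src = (\<lambda>k a. if k = 3 then a else 0),
      tgt = (\<lambda>k a. if k = 3 then a else 0),
      idn = (\<lambda>k a. a),
      cmp = (\<lambda>m k b a. if k = 2 then a else b + a)\<rparr>"

lemma nat_cat_simps:
  "a \<in> cells nat_cat k \<longleftrightarrow> (k \<le> Suc 0 \<longrightarrow> a = 0)"
  "src nat_cat k a = (if k = Suc (Suc (Suc 0)) then a else 0)"
  "tgt nat_cat k a = (if k = Suc (Suc (Suc 0)) then a else 0)"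
  "idn nat_cat k a = a"
  "cmp nat_cat m k b a = (if k = Suc (Suc 0) then a else b + a)"
  by (auto simp: nat_cat_def numeral_2_eq_2 numeral_3_eq_3)

text \<open>Both boundaries of a 3-cell \<open>a\<close> are \<open>a\<close>, so 3-cells composable
  along a 2-cell coincide, and returning one factor is a legitimate composite.\<close>

lemma nat_magma: "is_magma nat_cat"
proof -
  have "reflexive_globular nat_cat"
    unfolding reflexive_globular_def globular_def all_less_3 all_less_2 by (auto simp: nat_cat_simps)
  moreover have "cmp nat_cat (Suc m) k y x \<in> cells nat_cat (Suc m) \<and>
           src nat_cat (Suc m) (cmp nat_cat (Suc m) k y x) =
             (if k = m then src nat_cat (Suc m) x
              else cmp nat_cat m k (src nat_cat (Suc m) y) (src nat_cat (Suc m) x)) \<and>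
           tgt nat_cat (Suc m) (cmp nat_cat (Suc m) k y x) =
             (if k = m then tgt nat_cat (Suc m) y
              else cmp nat_cat m k (tgt nat_cat (Suc m) y) (tgt nat_cat (Suc m) x))"
    if k: "k \<le> m" and m: "m < 3" and x: "x \<in> cells nat_cat (Suc m)" and y: "y \<in> cells nat_cat (Suc m)"
      and e: "tgt_to nat_cat k (Suc m) x = src_to nat_cat k (Suc m) y" for m k x y
  proof -
    have "k < Suc m" "Suc m \<le> 3" using k m by simp_all
    then show ?thesis
      by (cases rule: dim_cases) (use x y e in \<open>auto simp: nat_cat_simps\<close>)
  qed
  ultimately show ?thesis unfolding is_magma_def by blast
qed

text \<open>Composition along 0-cells and along 1-cells is the same addition, so interchange between
  them amounts to commutativity of addition.\<close>

lemma nat_strict: "strict_3cat nat_cat"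
  unfolding strict_3cat_def
proof (intro conjI allI impI ballI; (elim conjE)?)
  show "is_magma nat_cat" by (rule nat_magma)
next
  fix m k x y z
  show "cmp nat_cat m k (cmp nat_cat m k z y) x = cmp nat_cat m k z (cmp nat_cat m k y x)"
    by (simp add: nat_cat_simps)
next
  fix m k :: nat and x
  assume a: "k < m" "m \<le> 3" "x \<in> cells nat_cat m"
  show "cmp nat_cat m k x (idn_to nat_cat k m (src_to nat_cat k m x)) = x"
    using a(1,2) by (cases rule: dim_cases) (use a(3) in \<open>auto simp: nat_cat_simps\<close>)
  show "cmp nat_cat m k (idn_to nat_cat k m (tgt_to nat_cat k m x)) x = x"
    using a(1,2) by (cases rule: dim_cases) (use a(3) in \<open>auto simp: nat_cat_simps\<close>)
next
  fix m l k :: nat and x y z w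
  assume "k < l" "l < m" "m \<le> 3"
  then show "cmp nat_cat m k (cmp nat_cat m l w z) (cmp nat_cat m l y x) =
      cmp nat_cat m l (cmp nat_cat m k w y) (cmp nat_cat m k z x)"
    by (simp add: nat_cat_simps)
next
  fix m k x y
  show "cmp nat_cat (Suc m) k (idn nat_cat m y) (idn nat_cat m x) = idn nat_cat m (cmp nat_cat m k y x)"
    by (simp add: nat_cat_simps)
qed

lemma nat_cat_algebra:
  obtains \<theta> where "N3_algebra (uglob nat_cat) \<theta>"
  using Q_object_N3_algebra[OF strict_Q_object[OF nat_strict]] by auto

section \<open>Composites of endomorphic 2-cells\<close>

text \<open>Horizontal composites lie on the composite 1-cell, whereas in \<open>vcomp_endo\<close>
  vertical ones stay on \<open>f\<close>. This difference separates the Eckmann-Hilton composites in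
  TA.\<close>

lemma hcomp_endo:
  assumes M: "is_magma M" and x: "src M 1 g = x" "tgt M 1 f = x"
    and X: "X \<in> cells M 2" "src M 2 X = f" "tgt M 2 X = f"
    and Y: "Y \<in> cells M 2" "src M 2 Y = g" "tgt M 2 Y = g"
  shows "hcomp M Y X \<in> cells M 2" "src M 2 (hcomp M Y X) = cmp M 1 0 g f"
    "tgt M 2 (hcomp M Y X) = cmp M 1 0 g f"
  using magmaD[OF M, of 0 1 X Y] assms by (simp_all add: numeral_2_eq_2)

lemma vcomp_endo:
  assumes M: "is_magma M"
    and X: "X \<in> cells M 2" "src M 2 X = f" "tgt M 2 X = f"
    and Y: "Y \<in> cells M 2" "src M 2 Y = f" "tgt M 2 Y = f"
  shows "vcomp M Y X \<in> cells M 2" "src M 2 (vcomp M Y X) = f" "tgt M 2 (vcomp M Y X) = f"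
  using magmaD[OF M, of 1 1 X Y] assms by (simp_all add: numeral_2_eq_2)

text \<open>In the nested entries, inner vertical composites lie on \<open>f\<close> and inner
  horizontal ones on the square of \<open>f\<close>, so every outer composition is defined.\<close>

lemma eckmann_hilton_cells:
  assumes M: "is_magma M" and f: "src M 1 f = x" "tgt M 1 f = x"
    and g: "src M 1 (cmp M 1 0 f f) = x" "tgt M 1 (cmp M 1 0 f f) = x"
    and e: "e \<in> cells M 2" "src M 2 e = f" "tgt M 2 e = f"
    and a: "a \<in> cells M 2" "src M 2 a = f" "tgt M 2 a = f"
    and b: "b \<in> cells M 2" "src M 2 b = f" "tgt M 2 b = f"
  shows "set (eckmann_hilton M e a b) \<subseteq> cells M 2"
proof -
  note h = hcomp_endo[OF M f] and v = vcomp_endo[OF M]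
  note hs = h[OF a b] h[OF b a] h[OF e a] h[OF e b] h[OF a e] h[OF b e]
  note vs = v[OF a b] v[OF b a] v[OF e a] v[OF e b] v[OF a e] v[OF b e]
  have "hcomp M (vcomp M b e) (vcomp M e a) \<in> cells M 2"
    "hcomp M (vcomp M e a) (vcomp M b e) \<in> cells M 2"
    "hcomp M (vcomp M a e) (vcomp M e b) \<in> cells M 2"
    "hcomp M (vcomp M e b) (vcomp M a e) \<in> cells M 2"
    by (rule h(1); fact vs)+
  moreover have "vcomp M (hcomp M b e) (hcomp M e a) \<in> cells M 2"
    "vcomp M (hcomp M e b) (hcomp M a e) \<in> cells M 2"
    "vcomp M (hcomp M a e) (hcomp M e b) \<in> cells M 2"
    "vcomp M (hcomp M e a) (hcomp M b e) \<in> cells M 2"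
    by (rule v(1); fact hs)+
  ultimately show ?thesis using hs vs by (simp add: eckmann_hilton_def)
qed

text \<open>The classical argument, available because the 2-cells lie on an identity 1-cell: both
  vertical composites equal the horizontal composite of \<open>a\<close> and
  \<open>b\<close>.\<close>

lemma eckmann_hilton_commute:
  assumes M: "strict_3cat M"
    and a: "a \<in> cells M 2" "src M 2 a = idn M 0 x" "tgt M 2 a = idn M 0 x"
    and b: "b \<in> cells M 2" "src M 2 b = idn M 0 x" "tgt M 2 b = idn M 0 x"
    and x: "x \<in> cells M 0"
  shows "vcomp M a b = vcomp M b a"
proof -
  note mag = strict_magma[OF M]
  define e where "e = idn M 1 (idn M 0 x)"
  note i = idnD[OF mag, of 0, simplified, OF x]
  have e: "e \<in> cells M 2" "src M 2 e = idn M 0 x" "tgt M 2 e = idn M 0 x"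
    using idnD[OF mag, of 1 "idn M 0 x"] i by (simp_all add: e_def numeral_2_eq_2)
  have to1: "src_to M (Suc 0) 2 z = src M 2 z" "tgt_to M (Suc 0) 2 z = tgt M 2 z" for z
    by (simp_all add: numeral_2_eq_2)
  have to0: "src_to M 0 2 z = src M (Suc 0) (src M 2 z)" "tgt_to M 0 2 z = tgt M (Suc 0) (tgt M 2 z)" for z
    by (simp_all add: numeral_2_eq_2)
  \<comment> \<open>The same \<open>e\<close> is the identity on the 1-cell and the twofold identity
    on \<open>x\<close>, hence a unit for both compositions.\<close>
  have it: "idn_to M 0 2 x = e" "idn_to M (Suc 0) 2 (idn M 0 x) = e"
    by (simp_all add: e_def numeral_2_eq_2)
  have v: "vcomp M z e = z" "vcomp M e z = z" and h: "hcomp M z e = z" "hcomp M e z = z"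
    if "z \<in> cells M 2" "src M 2 z = idn M 0 x" "tgt M 2 z = idn M 0 x" for z
    using strictD(2,3)[OF M, of 1 2 z] strictD(2,3)[OF M, of 0 2 z] that i
    by (simp_all add: to1 to0 it)
  have int: "hcomp M (vcomp M w z) (vcomp M y w') = vcomp M (hcomp M w y) (hcomp M z w')"
    if "w \<in> cells M 2" "src M 2 w = idn M 0 x" "tgt M 2 w = idn M 0 x"
      "z \<in> cells M 2" "src M 2 z = idn M 0 x" "tgt M 2 z = idn M 0 x"
      "y \<in> cells M 2" "src M 2 y = idn M 0 x" "tgt M 2 y = idn M 0 x"
      "w' \<in> cells M 2" "src M 2 w' = idn M 0 x" "tgt M 2 w' = idn M 0 x" for w z y w'
    using strictD(4)[OF M, of 0 1 2 w' y z w] that i by (simp add: to1 to0)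
  have "vcomp M a b = hcomp M a b" using int[OF a e e b] v[OF a] v[OF b] h[OF a] h[OF b] by simp
  moreover have "vcomp M b a = hcomp M a b" using int[OF e a b e] v[OF a] v[OF b] h[OF a] h[OF b] by simp
  ultimately show ?thesis by simp
qed

section \<open>Separating composites in TA for doubly degenerate A\<close>

lemma free_cat_endo:
  assumes A: "globular A" and d: "doubly_degenerate A" and x: "x \<in> cells A 0" and u: "u \<in> cells A 1"
  shows "free_cat_unit A 1 u \<in> cells (free_cat A) 1"
    "src (free_cat A) 1 (free_cat_unit A 1 u) = free_cat_unit A 0 x"
    "tgt (free_cat A) 1 (free_cat_unit A 1 u) = free_cat_unit A 0 x"
    "\<alpha> \<in> cells A 2 \<Longrightarrow> free_cat_unit A 2 \<alpha> \<in> cells (free_cat A) 2"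
    "\<alpha> \<in> cells A 2 \<Longrightarrow> src (free_cat A) 2 (free_cat_unit A 2 \<alpha>) = free_cat_unit A 1 u"
    "\<alpha> \<in> cells A 2 \<Longrightarrow> tgt (free_cat A) 2 (free_cat_unit A 2 \<alpha>) = free_cat_unit A 1 u"
proof -
  note m = free_unit_map[OF A, unfolded glob_map_def]
  note m1 = m[THEN conjunct1, rule_format] and m2 = m[THEN conjunct2, rule_format, THEN conjunct1, symmetric]
    m[THEN conjunct2, rule_format, THEN conjunct2, symmetric]
  have "src A 1 u = x" "tgt A 1 u = x"
    using globD[OF A, of 0 u] d x u by (auto simp: doubly_degenerate_def)
  then show "free_cat_unit A 1 u \<in> cells (free_cat A) 1"
    "src (free_cat A) 1 (free_cat_unit A 1 u) = free_cat_unit A 0 x"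
    "tgt (free_cat A) 1 (free_cat_unit A 1 u) = free_cat_unit A 0 x"
    using m1[of 1 u] m2[of 0 u] u by simp_all
  assume a: "\<alpha> \<in> cells A 2"
  have "src A 2 \<alpha> = u" "tgt A 2 \<alpha> = u"
    using globD[OF A, of 1 \<alpha>] d u a by (auto simp: doubly_degenerate_def numeral_2_eq_2)
  then show "free_cat_unit A 2 \<alpha> \<in> cells (free_cat A) 2"
    "src (free_cat A) 2 (free_cat_unit A 2 \<alpha>) = free_cat_unit A 1 u"
    "tgt (free_cat A) 2 (free_cat_unit A 2 \<alpha>) = free_cat_unit A 1 u"
    using m1[of 2 \<alpha>] m2[of 1 \<alpha>] a by (simp_all add: numeral_2_eq_2)
qed

text \<open>The functor to words sends the two composites to the distinct one-entry tuples
  \<open>[[\<alpha>, \<beta>]]\<close> and \<open>[[\<beta>, \<alpha>]]\<close>.\<close>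

lemma free_cat_vcomp_noncommuting:
  assumes A: "globular A" and d: "doubly_degenerate A"
    and a: "\<alpha> \<in> cells A 2" and b: "\<beta> \<in> cells A 2" and ne: "\<alpha> \<noteq> \<beta>"
  shows "vcomp (free_cat A) (free_cat_unit A 2 \<alpha>) (free_cat_unit A 2 \<beta>) \<noteq>
    vcomp (free_cat A) (free_cat_unit A 2 \<beta>) (free_cat_unit A 2 \<alpha>)"
proof -
  let ?T = "free_cat A" and ?\<eta> = "free_cat_unit A"
  obtain x u where xu: "x \<in> cells A 0" "u \<in> cells A 1" using d by (auto simp: doubly_degenerate_def)
  note E = free_cat_endo[OF A d xu]
  obtain h where h: "magma_map ?T word_cat h"
    and hu: "\<And>k a. k \<le> 3 \<Longrightarrow> a \<in> cells A k \<Longrightarrow> h k (?\<eta> k a) = word_gen A k a"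
    using free_cat_to_words[OF A] by blast
  have *: "h 2 (vcomp ?T (?\<eta> 2 \<alpha>) (?\<eta> 2 \<beta>)) = ([[\<alpha>, \<beta>]], [[\<alpha>, \<beta>]])"
    if "\<alpha> \<in> cells A 2" "\<beta> \<in> cells A 2" for \<alpha> \<beta>
  proof -
    have "tgt_to ?T 1 2 (?\<eta> 2 \<beta>) = src_to ?T 1 2 (?\<eta> 2 \<alpha>)"
      using E(5)[OF that(1)] E(6)[OF that(2)] by (simp add: numeral_2_eq_2)
    moreover have "(1::nat) < 2" "(2::nat) \<le> 3" by simp_all
    ultimately have "h 2 (vcomp ?T (?\<eta> 2 \<alpha>) (?\<eta> 2 \<beta>)) = vcomp word_cat (h 2 (?\<eta> 2 \<alpha>)) (h 2 (?\<eta> 2 \<beta>))"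
      using h E(4)[OF that(1)] E(4)[OF that(2)] unfolding magma_map_def by blast
    then show ?thesis
      using hu[of 2] that by (simp add: word_gen_def word_simps pointwise_def)
  qed
  show ?thesis using *[OF a b] *[OF b a] ne by auto
qed

text \<open>The number of words distinguishes them: 0 for the identity and 1 for the
  generator.\<close>

lemma free_cat_gen_ne_idn:
  assumes A: "globular A" and x: "x \<in> cells A 0" and u: "u \<in> cells A 1"
  shows "idn (free_cat A) 0 (free_cat_unit A 0 x) \<noteq> free_cat_unit A 1 u"
proof
  let ?T = "free_cat A" and ?\<eta> = "free_cat_unit A"
  obtain h where h: "magma_map ?T word_cat h"
    and hu: "\<And>k a. k \<le> 3 \<Longrightarrow> a \<in> cells A k \<Longrightarrow> h k (?\<eta> k a) = word_gen A k a"
    using free_cat_to_words[OF A] by blast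
  have "?\<eta> 0 x \<in> cells ?T 0" using free_unit_map[OF A] x by (simp add: glob_map_def)
  then have "h 1 (idn ?T 0 (?\<eta> 0 x)) = ([], [])"
    using h hu[of 0 x] x by (simp add: magma_map_def word_gen_def word_simps)
  moreover assume "idn ?T 0 (?\<eta> 0 x) = ?\<eta> 1 u"
  ultimately show False using hu[of 1 u] u by (simp add: word_gen_def)
qed

text \<open>Here the numbers of words are 2 and 1.\<close>

lemma free_cat_gen_ne_square:
  assumes A: "globular A" and d: "doubly_degenerate A" and u: "u \<in> cells A 1"
  shows "cmp (free_cat A) 1 0 (free_cat_unit A 1 u) (free_cat_unit A 1 u) \<noteq> free_cat_unit A 1 u"
proof
  let ?T = "free_cat A" and ?\<eta> = "free_cat_unit A"
  obtain x where x: "x \<in> cells A 0" using d by (auto simp: doubly_degenerate_def)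
  note E = free_cat_endo[OF A d x u]
  obtain h where h: "magma_map ?T word_cat h"
    and hu: "\<And>k a. k \<le> 3 \<Longrightarrow> a \<in> cells A k \<Longrightarrow> h k (?\<eta> k a) = word_gen A k a"
    using free_cat_to_words[OF A] by blast
  have "tgt_to ?T 0 1 (?\<eta> 1 u) = src_to ?T 0 1 (?\<eta> 1 u)" using E(2,3) by simp
  moreover have "(0::nat) < 1" "(1::nat) \<le> 3" by simp_all
  ultimately have "h 1 (cmp ?T 1 0 (?\<eta> 1 u) (?\<eta> 1 u)) = cmp word_cat 1 0 (h 1 (?\<eta> 1 u)) (h 1 (?\<eta> 1 u))"
    using h E(1) unfolding magma_map_def by blast
  moreover assume "cmp ?T 1 0 (?\<eta> 1 u) (?\<eta> 1 u) = ?\<eta> 1 u"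
  ultimately show False using hu[of 1 u] u by (simp add: word_gen_def word_simps)
qed

lemma free_cat_eckmann_hilton:
  fixes A :: "'a glob"
  assumes A: "globular A" and d: "doubly_degenerate A" and u: "u \<in> cells A 1"
    and a: "\<alpha> \<in> cells A 2" and b: "\<beta> \<in> cells A 2"
  defines "T \<equiv> free_cat A" and "\<eta> \<equiv> free_cat_unit A"
  defines "EH \<equiv> eckmann_hilton T (idn T 1 (\<eta> 1 u)) (\<eta> 2 \<alpha>) (\<eta> 2 \<beta>)"
  shows "set EH \<subseteq> cells T 2"
    and "\<not> (\<exists>p. \<forall>\<gamma>\<in>set EH. src T 2 \<gamma> = p)"
    and "\<not> (\<exists>q. \<forall>\<gamma>\<in>set EH. tgt T 2 \<gamma> = q)"
proof -
  obtain x where x: "x \<in> cells A 0" using d by (auto simp: doubly_degenerate_def)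
  note E = free_cat_endo[OF A d x u, folded T_def \<eta>_def]
  have mag: "is_magma T" unfolding T_def by (rule strict_magma[OF free_strict])
  have e: "idn T 1 (\<eta> 1 u) \<in> cells T 2" "src T 2 (idn T 1 (\<eta> 1 u)) = \<eta> 1 u"
    "tgt T 2 (idn T 1 (\<eta> 1 u)) = \<eta> 1 u"
    using idnD[OF mag, of 1 "\<eta> 1 u"] E(1) by (simp_all add: numeral_2_eq_2)
  have sq: "src T 1 (cmp T 1 0 (\<eta> 1 u) (\<eta> 1 u)) = \<eta> 0 x" "tgt T 1 (cmp T 1 0 (\<eta> 1 u) (\<eta> 1 u)) = \<eta> 0 x"
    using magmaD(2,3)[OF mag, of 0 0 "\<eta> 1 u" "\<eta> 1 u"] E(1-3) by simp_all
  show "set EH \<subseteq> cells T 2"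
    unfolding EH_def by (rule eckmann_hilton_cells[OF mag E(2,3) sq e E(4-6)[OF a] E(4-6)[OF b]])
  have ne: "cmp T 1 0 (\<eta> 1 u) (\<eta> 1 u) \<noteq> \<eta> 1 u"
    using free_cat_gen_ne_square[OF A d u] by (simp add: T_def \<eta>_def)
  \<comment> \<open>Two entries suffice: the horizontal composite lies on the square of
    \<open>\<eta> 1 u\<close>, the vertical one on \<open>\<eta> 1 u\<close> itself.\<close>
  have in_EH: "hcomp T (\<eta> 2 \<beta>) (\<eta> 2 \<alpha>) \<in> set EH" "vcomp T (\<eta> 2 \<beta>) (\<eta> 2 \<alpha>) \<in> set EH"
    by (simp_all add: EH_def eckmann_hilton_def)
  note h = hcomp_endo(2,3)[OF mag E(2,3) E(4-6)[OF a] E(4-6)[OF b]]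
  note v = vcomp_endo(2,3)[OF mag E(4-6)[OF a] E(4-6)[OF b]]
  show "\<not> (\<exists>p. \<forall>\<gamma>\<in>set EH. src T 2 \<gamma> = p)" using in_EH h(1) v(1) ne by metis
  show "\<not> (\<exists>q. \<forall>\<gamma>\<in>set EH. tgt T 2 \<gamma> = q)" using in_EH h(2) v(2) ne by metis
qed

section \<open>The reflexive version, where vertical composition commutes\<close>

lemma free_cat_refl_degenerate:
  assumes R: "reflexive_globular R" and d: "doubly_degenerate R"
    and x: "x \<in> cells R 0" and u: "u \<in> cells R 1"
  shows "free_cat_refl_unit R 1 u = idn (free_cat_refl R) 0 (free_cat_refl_unit R 0 x)"
proof -
  have "idn R 0 x \<in> cells R 1" using R x by (simp add: reflexive_globular_def)
  \<comment> \<open>Being the only 1-cell, \<open>u\<close> must be the given identity, which the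
    free reflexive construction turns into an identity of the 3-category.\<close>
  then have "u = idn R 0 x" using d u by (auto simp: doubly_degenerate_def)
  then show ?thesis using free_cat_refl_universal(3)[OF R, of 0 x] x by simp
qed

text \<open>The 2-cells coming from \<open>R\<close> all lie on the image of the unique 1-cell, now
  an identity, so the Eckmann-Hilton argument goes through.\<close>

lemma free_cat_refl_vcomp_commute:
  assumes R: "reflexive_globular R" and d: "doubly_degenerate R"
    and a: "\<alpha> \<in> cells R 2" and b: "\<beta> \<in> cells R 2"
  shows "vcomp (free_cat_refl R) (free_cat_refl_unit R 2 \<alpha>) (free_cat_refl_unit R 2 \<beta>) =
    vcomp (free_cat_refl R) (free_cat_refl_unit R 2 \<beta>) (free_cat_refl_unit R 2 \<alpha>)"
proof -
  let ?T = "free_cat_refl R" and ?\<eta> = "free_cat_refl_unit R"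
  obtain x u where x: "x \<in> cells R 0" and u: "u \<in> cells R 1" using d by (auto simp: doubly_degenerate_def)
  note m = free_cat_refl_universal(2)[OF R, unfolded glob_map_def]
  note m1 = m[THEN conjunct1, rule_format] and m2 = m[THEN conjunct2, rule_format, THEN conjunct1, symmetric]
    m[THEN conjunct2, rule_format, THEN conjunct2, symmetric]
  have "globular R" using R by (simp add: reflexive_globular_def)
  then have "src R 2 c = u \<and> tgt R 2 c = u" if "c \<in> cells R 2" for c
    using globD[of R 1 c] d u that by (auto simp: doubly_degenerate_def numeral_2_eq_2)
  then have "?\<eta> 2 c \<in> cells ?T 2 \<and> src ?T 2 (?\<eta> 2 c) = ?\<eta> 1 u \<and> tgt ?T 2 (?\<eta> 2 c) = ?\<eta> 1 u"
    if "c \<in> cells R 2" for c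
    using m1[of 2 c] m2[of 1 c] that by (simp add: numeral_2_eq_2)
  then show ?thesis
    using eckmann_hilton_commute[OF free_cat_refl_universal(1)[OF R], of "?\<eta> 2 \<alpha>" "?\<eta> 0 x" "?\<eta> 2 \<beta>"]
      m1[of 0 x] x a b free_cat_refl_degenerate[OF R d x u] by simp
qed

text \<open>Noncommutativity in the first conjunct concerns distinct 2-cells and is vacuous if
  \<open>A\<close> has fewer than two; the second conjunct exhibits an algebra where it occurs. The
  third gives the contrast with the reflexive version.\<close>

theorem mainTheorem4:
  shows
    "(\<forall>(A :: 'a glob) \<theta> x u.
        N3_algebra A \<theta> \<and> doubly_degenerate A \<and> x \<in> cells A 0 \<and> u \<in> cells A 1 \<longrightarrow>
          (let TA = free_cat A; \<eta> = free_cat_unit A in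
             (\<exists>!f. f \<in> cells A 1) \<and> \<not> (\<exists>!f. f \<in> cells TA 1) \<and>
             \<eta> 1 u \<in> cells TA 1 \<and> generated_1cells TA {\<eta> 1 u} = cells TA 1 \<and>
             idn TA 0 (\<eta> 0 x) \<in> cells TA 1 \<and> idn TA 0 (\<eta> 0 x) \<noteq> \<eta> 1 u \<and>
             (\<forall>\<alpha>\<in>cells A 2. \<forall>\<beta>\<in>cells A 2. \<alpha> \<noteq> \<beta> \<longrightarrow>
                vcomp TA (\<eta> 2 \<alpha>) (\<eta> 2 \<beta>) \<noteq> vcomp TA (\<eta> 2 \<beta>) (\<eta> 2 \<alpha>)) \<and>
             (\<forall>\<alpha>\<in>cells A 2. \<forall>\<beta>\<in>cells A 2.
                let EH = eckmann_hilton TA (idn TA 1 (\<eta> 1 u)) (\<eta> 2 \<alpha>) (\<eta> 2 \<beta>) in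
                  set EH \<subseteq> cells TA 2 \<and>
                  \<not> (\<exists>p. \<forall>\<gamma>\<in>set EH. src TA 2 \<gamma> = p) \<and>
                  \<not> (\<exists>q. \<forall>\<gamma>\<in>set EH. tgt TA 2 \<gamma> = q) \<and>
                  \<not> (\<exists>\<delta>. \<forall>\<gamma>\<in>set EH. \<gamma> = \<delta>)))) \<and>
     (\<exists>(A :: nat glob) \<theta>. N3_algebra A \<theta> \<and> doubly_degenerate A \<and>
        (\<exists>\<alpha>\<in>cells A 2. \<exists>\<beta>\<in>cells A 2.
           vcomp (free_cat A) (free_cat_unit A 2 \<alpha>) (free_cat_unit A 2 \<beta>) \<noteq>
           vcomp (free_cat A) (free_cat_unit A 2 \<beta>) (free_cat_unit A 2 \<alpha>))) \<and>
     (\<forall>(R :: 'r rglob) x u.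
        reflexive_globular R \<and> doubly_degenerate R \<and> x \<in> cells R 0 \<and> u \<in> cells R 1 \<longrightarrow>
          (let TR = free_cat_refl R; \<eta> = free_cat_refl_unit R in
             \<eta> 1 u = idn TR 0 (\<eta> 0 x) \<and>
             (\<forall>\<alpha>\<in>cells R 2. \<forall>\<beta>\<in>cells R 2.
                vcomp TR (\<eta> 2 \<alpha>) (\<eta> 2 \<beta>) = vcomp TR (\<eta> 2 \<beta>) (\<eta> 2 \<alpha>))))"
proof (intro conjI allI impI; (elim conjE)?)
  fix A :: "'a glob" and \<theta> x u
  assume "N3_algebra A \<theta>" and d: "doubly_degenerate A" and x: "x \<in> cells A 0" and u: "u \<in> cells A 1"
  then have A: "globular A" by (simp add: N3_algebra_def)
  let ?T = "free_cat A" and ?\<eta> = "free_cat_unit A"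
  have mag: "is_magma ?T" by (rule strict_magma[OF free_strict])
  have A1: "cells A 1 = {u}" using d u by (auto simp: doubly_degenerate_def)
  have eta: "?\<eta> 1 u \<in> cells ?T 1" by (rule free_cat_endo(1)[OF A d x u])
  have idn: "idn ?T 0 (?\<eta> 0 x) \<in> cells ?T 1"
    using idnD(1)[OF mag, of 0] free_unit_map[OF A] x by (simp add: glob_map_def)
  have ne: "idn ?T 0 (?\<eta> 0 x) \<noteq> ?\<eta> 1 u" by (rule free_cat_gen_ne_idn[OF A x u])
  have gen: "generated_1cells ?T {?\<eta> 1 u} = cells ?T 1"
    using generated_1cells_free_cat[OF A] A1 by simp
  have nc: "\<forall>\<alpha>\<in>cells A 2. \<forall>\<beta>\<in>cells A 2. \<alpha> \<noteq> \<beta> \<longrightarrow>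
      vcomp ?T (?\<eta> 2 \<alpha>) (?\<eta> 2 \<beta>) \<noteq> vcomp ?T (?\<eta> 2 \<beta>) (?\<eta> 2 \<alpha>)"
    using free_cat_vcomp_noncommuting[OF A d] by blast
  have EH: "\<forall>\<alpha>\<in>cells A 2. \<forall>\<beta>\<in>cells A 2.
      let EH = eckmann_hilton ?T (idn ?T 1 (?\<eta> 1 u)) (?\<eta> 2 \<alpha>) (?\<eta> 2 \<beta>) in
        set EH \<subseteq> cells ?T 2 \<and>
        \<not> (\<exists>p. \<forall>\<gamma>\<in>set EH. src ?T 2 \<gamma> = p) \<and>
        \<not> (\<exists>q. \<forall>\<gamma>\<in>set EH. tgt ?T 2 \<gamma> = q) \<and>
        \<not> (\<exists>\<delta>. \<forall>\<gamma>\<in>set EH. \<gamma> = \<delta>)"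
  proof (intro ballI)
    fix \<alpha> \<beta> assume a: "\<alpha> \<in> cells A 2" and b: "\<beta> \<in> cells A 2"
    let ?EH = "eckmann_hilton ?T (idn ?T 1 (?\<eta> 1 u)) (?\<eta> 2 \<alpha>) (?\<eta> 2 \<beta>)"
    note E = free_cat_eckmann_hilton[OF A d u a b]
    \<comment> \<open>Equal composites would share a source.\<close>
    have "\<not> (\<exists>\<delta>. \<forall>\<gamma>\<in>set ?EH. \<gamma> = \<delta>)" using E(2) by metis
    with E show "let EH = ?EH in
        set EH \<subseteq> cells ?T 2 \<and>
        \<not> (\<exists>p. \<forall>\<gamma>\<in>set EH. src ?T 2 \<gamma> = p) \<and>
        \<not> (\<exists>q. \<forall>\<gamma>\<in>set EH. tgt ?T 2 \<gamma> = q) \<and>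
        \<not> (\<exists>\<delta>. \<forall>\<gamma>\<in>set EH. \<gamma> = \<delta>)"
      unfolding Let_def by (intro conjI)
  qed
  show "let TA = ?T; \<eta> = ?\<eta> in
             (\<exists>!f. f \<in> cells A 1) \<and> \<not> (\<exists>!f. f \<in> cells TA 1) \<and>
             \<eta> 1 u \<in> cells TA 1 \<and> generated_1cells TA {\<eta> 1 u} = cells TA 1 \<and>
             idn TA 0 (\<eta> 0 x) \<in> cells TA 1 \<and> idn TA 0 (\<eta> 0 x) \<noteq> \<eta> 1 u \<and>
             (\<forall>\<alpha>\<in>cells A 2. \<forall>\<beta>\<in>cells A 2. \<alpha> \<noteq> \<beta> \<longrightarrow>
                vcomp TA (\<eta> 2 \<alpha>) (\<eta> 2 \<beta>) \<noteq> vcomp TA (\<eta> 2 \<beta>) (\<eta> 2 \<alpha>)) \<and>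
             (\<forall>\<alpha>\<in>cells A 2. \<forall>\<beta>\<in>cells A 2.
                let EH = eckmann_hilton TA (idn TA 1 (\<eta> 1 u)) (\<eta> 2 \<alpha>) (\<eta> 2 \<beta>) in
                  set EH \<subseteq> cells TA 2 \<and>
                  \<not> (\<exists>p. \<forall>\<gamma>\<in>set EH. src TA 2 \<gamma> = p) \<and>
                  \<not> (\<exists>q. \<forall>\<gamma>\<in>set EH. tgt TA 2 \<gamma> = q) \<and>
                  \<not> (\<exists>\<delta>. \<forall>\<gamma>\<in>set EH. \<gamma> = \<delta>))"
    unfolding Let_def[of ?T] Let_def[of ?\<eta>]
  proof (intro conjI)
    show "\<exists>!f. f \<in> cells A 1" using A1 by simp
    show "\<not> (\<exists>!f. f \<in> cells ?T 1)" using eta idn ne by blast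
  qed (fact eta gen idn ne nc EH)+
next
  let ?A = "uglob nat_cat"
  obtain \<theta> where \<theta>: "N3_algebra ?A \<theta>" by (rule nat_cat_algebra)
  have d: "doubly_degenerate ?A"
    by (auto simp: doubly_degenerate_def nat_cat_simps)
  have c: "0 \<in> cells ?A 2" "1 \<in> cells ?A 2"
    by (simp_all add: nat_cat_simps)
  have A: "globular ?A" using magma_glob[OF nat_magma] by simp
  \<comment> \<open>TA depends only on the globular set and not on its addition, so the generators 0
    and 1 fail to commute although addition in \<open>nat_cat\<close> does.\<close>
  have "vcomp (free_cat ?A) (free_cat_unit ?A 2 0) (free_cat_unit ?A 2 1) \<noteq>
      vcomp (free_cat ?A) (free_cat_unit ?A 2 1) (free_cat_unit ?A 2 0)"
    by (rule free_cat_vcomp_noncommuting[OF A d c zero_neq_one])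
  then show "\<exists>(A :: nat glob) \<theta>. N3_algebra A \<theta> \<and> doubly_degenerate A \<and>
        (\<exists>\<alpha>\<in>cells A 2. \<exists>\<beta>\<in>cells A 2.
           vcomp (free_cat A) (free_cat_unit A 2 \<alpha>) (free_cat_unit A 2 \<beta>) \<noteq>
           vcomp (free_cat A) (free_cat_unit A 2 \<beta>) (free_cat_unit A 2 \<alpha>))"
    by (intro exI[of _ ?A] exI[of _ \<theta>] conjI \<theta> d bexI[OF _ c(1)] bexI[OF _ c(2)])
next
  fix R :: "'r rglob" and x u
  assume R: "reflexive_globular R" "doubly_degenerate R" "x \<in> cells R 0" "u \<in> cells R 1"
  show "let TR = free_cat_refl R; \<eta> = free_cat_refl_unit R in
             \<eta> 1 u = idn TR 0 (\<eta> 0 x) \<and>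
             (\<forall>\<alpha>\<in>cells R 2. \<forall>\<beta>\<in>cells R 2.
                vcomp TR (\<eta> 2 \<alpha>) (\<eta> 2 \<beta>) = vcomp TR (\<eta> 2 \<beta>) (\<eta> 2 \<alpha>))"
    using free_cat_refl_degenerate[OF R] free_cat_refl_vcomp_commute[OF R(1,2)] by (simp add: Let_def)
qed

end
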